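(* Let $\mathbf E$ be an $n$-dimensional nilpotent evolution algebra of maximal nilindex in the normal form given in the context, with obstruction index $i_0$. Let $\mathcal V_0$ be the set of linear maps $T_{\mathbf c}$, $\mathbf c=(c_1,\dots,c_n)\in\mathbb K^n$, defined by $T_{\mathbf c}(\mathbf e_i)=c_i\mathbf e_n$ $(1\le i\le n)$. For each $k\in\{i_0+1,\dots,n-1\}$, let $\mathcal V_k$ be the set of linear maps $T^{(k)}_{\alpha,\mathbf c}$, $\alpha\in\mathbb K^\times$, $\mathbf c=(c_1,\dots,c_n)\in\mathbb K^n$, defined by $$T^{(k)}_{\alpha,\mathbf c}(\mathbf e_i)=\begin{cases} c_i\mathbf e_n, & 1\le i<k,\\ 2^{n-i}\alpha\,\mathbf e_i+c_i\mathbf e_n, & k\le i<n,\\ c_n\mathbf e_n, & i=n.\end{cases}$$ Then the set of local Rota--Baxter operators of weight zero decomposes as the disjoint union $$\mathrm{LRB}_0(\mathbf E)=\mathcal V_0\ \sqcup\ \bigcup_{k=i_0+1}^{n-1}\mathcal V_k .$$ Moreover: (1) $\mathcal V_0$ is an affine subspace of $\mathrm{End}(\mathbf E)$ of dimension $n$, canonically isomorphic to $\mathbb K^n$; (2) for each $k\in\{i_0+1,\dots,n-1\}$, $\mathcal V_k$ is a quasi-affine irreducible subset of $\mathrm{End}(\mathbf E)$, canonically isomorphic to $\mathbb K^n\times\mathbb K^\times$, and hence $\dim\mathcal V_k=n+1$; (3) for each $k\in\{i_0+1,\dots,n-1\}$, the Zariski closure of $\mathcal V_k$ is $\overline{\mathcal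 V_k}=\mathcal V_k\cup\mathcal V_0$, so $\mathcal V_0$ is the common boundary of all the strata $\mathcal V_k$, $k\ge i_0+1$; (4) consequently, $\dim\mathrm{LRB}_0(\mathbf E)=n+1$.
   Context: $\mathbb K$ is a field of characteristic zero and $n\ge 3$. An evolution algebra is an algebra with a basis $\{\mathbf e_1,\dots,\mathbf e_n\}$ (a natural basis) such that $\mathbf e_i\mathbf e_j=0$ for $i\ne j$. Every $n$-dimensional nilpotent evolution algebra of maximal nilindex over $\mathbb K$ admits a natural basis with $$\mathbf e_i^2=\mathbf e_{i+1}+\sum_{j=i+2}^{n-1}a_{ij}\mathbf e_j\ (1\le i\le n-3),\quad \mathbf e_{n-2}^2=\mathbf e_{n-1},\quad \mathbf e_{n-1}^2=\mathbf e_n,\quad \mathbf e_n^2=0,$$ with $a_{ij}\in\mathbb K$; $\mathbf E$ denotes such an algebra with this fixed basis (the normal form). Put $\mathcal I_A=\{(i,j): i+1<j<n,\ a_{ij}\ne0\}$, and define the obstruction index $i_0=0$ if $\mathcal I_A=\varnothing$, and $i_0=\max\{i:(i,j)\in\mathcal I_A\text{ for some }j\}$ otherwise. A linear map $R:\mathbf E\to\mathbf E$ is a Rota--Baxter operator of weight $0$ if $R(x)R(y)=R(R(x)y+xR(y))$ for all $x,y\in\mathbf E$; the set of these is $\mathrm{RB}_0(\mathbf E)$. A linear map $T:\mathbf E\to\mathbf E$ is a local Rota--Baxter operator of weight $0$ if for every $x\in\mathbf E$ there is $R_x\in\mathrm{RB}_0(\mathbf E)$ with $T(x)=R_x(x)$;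 the set of these is $\mathrm{LRB}_0(\mathbf E)$. $\mathrm{End}(\mathbf E)$ is the space of linear endomorphisms, regarded as affine space $\mathbb K^{n^2}$ with the Zariski topology; $\dim$ is the Zariski (Krull) dimension. The canonical isomorphisms are those given by the parameters $\mathbf c$, respectively $(\mathbf c,\alpha)$. $\mathbb K^\times=\mathbb K\setminus\{0\}$. *)

theory Defs
  imports
    "HOL-Analysis.Abstract_Topology"
    "HOL-Library.Function_Algebras"
    "HOL-Library.Disjoint_Sets"
    "HOL-Library.Extended_Nat"
begin

section \<open>Zariski topology on an affine space given by coordinate functions\<close>

text \<open>
  An affine space over \<open>'k\<close> is presented by its set of points together with a set of coordinate
  functions on it, which identify the points bijectively with some \<open>'k\<^sup>m\<close>.
  All varieties are taken in the sense of sets of \<open>'k\<close>-points.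
\<close>

type_synonym ('x, 'k) affine_space = "'x set \<times> ('x \<Rightarrow> 'k) set"

abbreviation points :: "('x, 'k) affine_space \<Rightarrow> 'x set" where "points \<equiv> fst"
abbreviation coords :: "('x, 'k) affine_space \<Rightarrow> ('x \<Rightarrow> 'k) set" where "coords \<equiv> snd"

inductive_set poly_funs :: "('x, 'k::field) affine_space \<Rightarrow> ('x \<Rightarrow> 'k) set"
  for A :: "('x, 'k) affine_space" where
  const: "(\<lambda>_. a) \<in> poly_funs A"
| coord: "f \<in> coords A \<Longrightarrow> f \<in> poly_funs A"
| add: "f \<in> poly_funs A \<Longrightarrow> g \<in> poly_funs A \<Longrightarrow> (\<lambda>x. f x + g x) \<in> poly_funs A"
| mult: "f \<in> poly_funs A \<Longrightarrow> g \<in> poly_funs A \<Longrightarrow> (\<lambda>x. f x * g x) \<in> poly_funs A"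

definition zero_locus :: "('x, 'k::field) affine_space \<Rightarrow> ('x \<Rightarrow> 'k) set \<Rightarrow> 'x set" where
  "zero_locus A P = {x \<in> points A. \<forall>p\<in>P. p x = 0}"

definition zariski :: "('x, 'k::field) affine_space \<Rightarrow> 'x topology" where
  "zariski A = topology (\<lambda>U. \<exists>P \<subseteq> poly_funs A. U = points A - zero_locus A P)"

lemma openin_zariski:
  "openin (zariski A) U \<longleftrightarrow> (\<exists>P \<subseteq> poly_funs A. U = points A - zero_locus A P)"
proof -
  let ?L = "\<lambda>U. \<exists>P \<subseteq> poly_funs A. U = points A - zero_locus A P"
  have "istopology ?L"
    unfolding istopology_def
  proof (intro conjI allI impI)
    fix S T assume "?L S" "?L T"
    then obtain P Q where P: "P \<subseteq> poly_funs A" "S = points A - zero_locus A P"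
      and Q: "Q \<subseteq> poly_funs A" "T = points A - zero_locus A Q" by auto
    let ?R = "{(\<lambda>x. p x * q x) |p q. p \<in> P \<and> q \<in> Q}"
    have "?R \<subseteq> poly_funs A" using P Q by (auto intro: poly_funs.mult)
    moreover have "S \<inter> T = points A - zero_locus A ?R"
      unfolding P Q zero_locus_def by fastforce
    ultimately show "?L (S \<inter> T)" by blast
  next
    fix \<K> assume K: "\<forall>K\<in>\<K>. ?L K"
    let ?R = "\<Union>{P. P \<subseteq> poly_funs A \<and> points A - zero_locus A P \<in> \<K>}"
    have "?R \<subseteq> poly_funs A" by blast
    moreover have "\<Union>\<K> = points A - zero_locus A ?R"
    proof (intro equalityI subsetI)
      fix x assume "x \<in> \<Union>\<K>"
      then obtain k where k: "k \<in> \<K>" "x \<in> k" by blast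
      with K obtain P where "P \<subseteq> poly_funs A" "k = points A - zero_locus A P" by blast
      with k show "x \<in> points A - zero_locus A ?R" by (auto simp: zero_locus_def)
    next
      fix x assume "x \<in> points A - zero_locus A ?R"
      then obtain p P where "x \<in> points A" "p \<in> P" "p x \<noteq> 0"
        "points A - zero_locus A P \<in> \<K>" by (auto simp: zero_locus_def)
      then show "x \<in> \<Union>\<K>"
        by (intro UnionI[of "points A - zero_locus A P"]) (auto simp: zero_locus_def)
    qed
    ultimately show "?L (\<Union>\<K>)" by blast
  qed
  then show ?thesis by (simp add: zariski_def)
qed

lemma topspace_zariski [simp]: "topspace (zariski A) = points A"
proof -
  have "openin (zariski A) (points A)"
    unfolding openin_zariski zero_locus_def
    by (intro exI[of _ "{\<lambda>_. 1}"]) (auto intro: poly_funs.const)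
  then show ?thesis
    by (metis (no_types, lifting) Diff_subset openin_zariski openin_subset openin_topspace subset_antisym)
qed

lemma closedin_zariski:
  "closedin (zariski A) Z \<longleftrightarrow> (\<exists>P \<subseteq> poly_funs A. Z = zero_locus A P)"
  unfolding closedin_def openin_zariski topspace_zariski zero_locus_def by blast


section \<open>Irreducibility, dimension, locally closed sets\<close>

definition irreducible_space :: "'x topology \<Rightarrow> bool" where
  "irreducible_space X \<longleftrightarrow> topspace X \<noteq> {} \<and>
     (\<forall>A B. closedin X A \<longrightarrow> closedin X B \<longrightarrow> A \<union> B = topspace X \<longrightarrow> A = topspace X \<or> B = topspace X)"

definition irreducible_in :: "'x topology \<Rightarrow> 'x set \<Rightarrow> bool" where
  "irreducible_in X S \<longleftrightarrow> S \<subseteq> topspace X \<and> irreducible_space (subtopology X S)"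

text \<open>Krull dimension; the empty space, for which conventions differ, receives the value \<open>0\<close>.\<close>

definition krull_dim :: "'x topology \<Rightarrow> enat" where
  "krull_dim X = Sup {enat r |r. \<exists>Z :: nat \<Rightarrow> 'x set.
     (\<forall>i\<le>r. closedin X (Z i) \<and> irreducible_in X (Z i)) \<and> (\<forall>i<r. Z i \<subset> Z (Suc i))}"

definition quasi_affine :: "('x, 'k::field) affine_space \<Rightarrow> 'x set \<Rightarrow> bool" where
  "quasi_affine A S \<longleftrightarrow> (\<exists>U C. openin (zariski A) U \<and> closedin (zariski A) C \<and> S = U \<inter> C)"


section \<open>Regular functions and isomorphisms of quasi-affine sets\<close>

definition regular_fun :: "('x, 'k::field) affine_space \<Rightarrow> 'x set \<Rightarrow> ('x \<Rightarrow> 'k) \<Rightarrow> bool" where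
  "regular_fun A S f \<longleftrightarrow> (\<forall>x\<in>S. \<exists>U. openin (subtopology (zariski A) S) U \<and> x \<in> U \<and>
     (\<exists>p\<in>poly_funs A. \<exists>q\<in>poly_funs A. \<forall>y\<in>U. q y \<noteq> 0 \<and> f y = p y / q y))"

definition regular_map ::
  "('x, 'k::field) affine_space \<Rightarrow> 'x set \<Rightarrow> ('y, 'k) affine_space \<Rightarrow> 'y set \<Rightarrow> ('x \<Rightarrow> 'y) \<Rightarrow> bool" where
  "regular_map A S B T \<phi> \<longleftrightarrow> \<phi> ` S \<subseteq> T \<and> (\<forall>g\<in>coords B. regular_fun A S (g \<circ> \<phi>))"

definition variety_iso ::
  "('x, 'k::field) affine_space \<Rightarrow> 'x set \<Rightarrow> ('y, 'k) affine_space \<Rightarrow> 'y set \<Rightarrow> ('x \<Rightarrow> 'y) \<Rightarrow> bool" where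
  "variety_iso A S B T \<phi> \<longleftrightarrow>
     bij_betw \<phi> S T \<and> regular_map A S B T \<phi> \<and> regular_map B T A S (inv_into S \<phi>)"

text \<open>\<open>'k\<^sup>n\<close> is realised by the functions on \<open>nat\<close> vanishing outside \<open>{1..n}\<close>.\<close>

definition Kn :: "nat \<Rightarrow> (nat \<Rightarrow> 'k::field) set" where
  "Kn n = {c. \<forall>i. i \<notin> {1..n} \<longrightarrow> c i = 0}"

definition Kn_space :: "nat \<Rightarrow> (nat \<Rightarrow> 'k::field, 'k) affine_space" where
  "Kn_space n = (Kn n, {(\<lambda>c. c i) |i. i \<in> {1..n}})"

definition Kn_times_K_space :: "nat \<Rightarrow> ((nat \<Rightarrow> 'k::field) \<times> 'k, 'k) affine_space" where
  "Kn_times_K_space n = (Kn n \<times> UNIV, {(\<lambda>(c, \<alpha>). c i) |i. i \<in> {1..n}} \<union> {\<lambda>(c, \<alpha>). \<alpha>})"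


section \<open>Evolution algebras of maximal nilindex\<close>

text \<open>
  The algebra is the whole type \<open>'v\<close>. Commutativity, nilpotency and maximality of the nilindex follow
  from the multiplication table. Values of \<open>e\<close> and \<open>a\<close> outside the relevant index ranges are
  irrelevant.
\<close>

locale evolution_algebra = vector_space scale
  for scale :: "'k::field_char_0 \<Rightarrow> 'v::ab_group_add \<Rightarrow> 'v" +
  fixes mul :: "'v \<Rightarrow> 'v \<Rightarrow> 'v" and n :: nat and e :: "nat \<Rightarrow> 'v"
  assumes mul_linear_right: "Vector_Spaces.linear scale scale (\<lambda>y. mul x y)"
    and mul_linear_left: "Vector_Spaces.linear scale scale (\<lambda>x. mul x y)"
    and inj_basis: "inj_on e {1..n}"
    and independent_basis: "independent (e ` {1..n})"
    and span_basis: "span (e ` {1..n}) = UNIV"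
    and mul_distinct: "i \<in> {1..n} \<Longrightarrow> j \<in> {1..n} \<Longrightarrow> i \<noteq> j \<Longrightarrow> mul (e i) (e j) = 0"

locale max_nilindex_normal_form = evolution_algebra scale mul n e
  for scale :: "'k::field_char_0 \<Rightarrow> 'v::ab_group_add \<Rightarrow> 'v" and mul n e +
  fixes a :: "nat \<Rightarrow> nat \<Rightarrow> 'k"
  assumes n_ge_3: "n \<ge> 3"
    and square: "1 \<le> i \<Longrightarrow> i \<le> n - 3 \<Longrightarrow>
      mul (e i) (e i) = e (i + 1) + (\<Sum>j = i + 2..n - 1. scale (a i j) (e j))"
    and square_n2: "mul (e (n - 2)) (e (n - 2)) = e (n - 1)"
    and square_n1: "mul (e (n - 1)) (e (n - 1)) = e n"
    and square_n: "mul (e n) (e n) = 0"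

definition obstruction_set :: "nat \<Rightarrow> (nat \<Rightarrow> nat \<Rightarrow> 'k::field) \<Rightarrow> (nat \<times> nat) set" where
  "obstruction_set n a = {(i, j). 1 \<le> i \<and> i + 1 < j \<and> j < n \<and> a i j \<noteq> 0}"

definition obstruction_index :: "nat \<Rightarrow> (nat \<Rightarrow> nat \<Rightarrow> 'k::field) \<Rightarrow> nat" where
  "obstruction_index n a =
     (if obstruction_set n a = {} then 0 else Max {i. \<exists>j. (i, j) \<in> obstruction_set n a})"


section \<open>Rota--Baxter and local Rota--Baxter operators of weight zero\<close>

definition End :: "('k::field \<Rightarrow> 'v::ab_group_add \<Rightarrow> 'v) \<Rightarrow> ('v \<Rightarrow> 'v) set" where
  "End scale = {f. Vector_Spaces.linear scale scale f}"

definition RB0 :: "('k::field \<Rightarrow> 'v::ab_group_add \<Rightarrow> 'v) \<Rightarrow> ('v \<Rightarrow> 'v \<Rightarrow> 'v) \<Rightarrow> ('v \<Rightarrow> 'v) set" where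
  "RB0 scale mul = {R \<in> End scale. \<forall>x y. mul (R x) (R y) = R (mul (R x) y + mul x (R y))}"

definition LRB0 :: "('k::field \<Rightarrow> 'v::ab_group_add \<Rightarrow> 'v) \<Rightarrow> ('v \<Rightarrow> 'v \<Rightarrow> 'v) \<Rightarrow> ('v \<Rightarrow> 'v) set" where
  "LRB0 scale mul = {T \<in> End scale. \<forall>x. \<exists>R\<in>RB0 scale mul. T x = R x}"


section \<open>The space of endomorphisms\<close>

definition coord ::
  "('k::field \<Rightarrow> 'v::ab_group_add \<Rightarrow> 'v) \<Rightarrow> nat \<Rightarrow> (nat \<Rightarrow> 'v) \<Rightarrow> nat \<Rightarrow> 'v \<Rightarrow> 'k" where
  "coord scale n e i x = module.representation scale (e ` {1..n}) x (e i)"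

definition End_space ::
  "('k::field \<Rightarrow> 'v::ab_group_add \<Rightarrow> 'v) \<Rightarrow> nat \<Rightarrow> (nat \<Rightarrow> 'v) \<Rightarrow> ('v \<Rightarrow> 'v, 'k) affine_space" where
  "End_space scale n e =
     (End scale, {(\<lambda>f. coord scale n e i (f (e j))) |i j. i \<in> {1..n} \<and> j \<in> {1..n}})"

definition fun_scale :: "('k \<Rightarrow> 'v \<Rightarrow> 'v) \<Rightarrow> 'k \<Rightarrow> ('x \<Rightarrow> 'v) \<Rightarrow> 'x \<Rightarrow> 'v" where
  "fun_scale scale r f = (\<lambda>x. scale r (f x))"

text \<open>Addition of maps is pointwise.\<close>

definition affine_subspace_of_dim ::
  "('k::field \<Rightarrow> 'v::ab_group_add \<Rightarrow> 'v) \<Rightarrow> ('v \<Rightarrow> 'v) set \<Rightarrow> nat \<Rightarrow> bool" where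
  "affine_subspace_of_dim scale S d \<longleftrightarrow> S \<subseteq> End scale \<and>
     (\<exists>f W. module.subspace (fun_scale scale) W \<and> vector_space.dim (fun_scale scale) W = d \<and>
        S = (\<lambda>w. f + w) ` W)"

lemma vector_space_fun_scale:
  assumes "vector_space scale"
  shows "vector_space (fun_scale scale)"
  using assms by (simp add: vector_space_def fun_scale_def fun_eq_iff)

text \<open>The linear map sending \<open>e i\<close> to \<open>g i\<close> for \<open>i \<in> {1..n}\<close>.\<close>

definition lin_ext ::
  "('k::field \<Rightarrow> 'v::ab_group_add \<Rightarrow> 'v) \<Rightarrow> nat \<Rightarrow> (nat \<Rightarrow> 'v) \<Rightarrow> (nat \<Rightarrow> 'v) \<Rightarrow> 'v \<Rightarrow> 'v" where
  "lin_ext scale n e g x = (\<Sum>i = 1..n. scale (coord scale n e i x) (g i))"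

lemma (in evolution_algebra) linear_lin_ext: "lin_ext scale n e g \<in> End scale"
proof -
  have "module_hom scale scale (lin_ext scale n e g)"
    unfolding module_hom_iff lin_ext_def coord_def
    using independent_basis span_basis
    by (simp add: module_axioms representation_add representation_scale scale_left_distrib
        sum.distrib scale_sum_right)
  then show ?thesis
    by (simp add: End_def Vector_Spaces.linear_def vector_space_axioms)
qed

lemma (in evolution_algebra) lin_ext_basis:
  assumes "j \<in> {1..n}"
  shows "lin_ext scale n e g (e j) = g j"
proof -
  have "coord scale n e i (e j) = (if i = j then 1 else 0)" if "i \<in> {1..n}" for i
    unfolding coord_def using representation_basis[OF independent_basis, of "e j"] assms that
      inj_on_eq_iff[OF inj_basis that assms] by auto
  then have "lin_ext scale n e g (e j) = (\<Sum>i = 1..n. if i = j then g i else 0)"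
    unfolding lin_ext_def by (intro sum.cong) auto
  then show ?thesis using assms by simp
qed


section \<open>The strata\<close>

definition T0 ::
  "('k::field \<Rightarrow> 'v::ab_group_add \<Rightarrow> 'v) \<Rightarrow> nat \<Rightarrow> (nat \<Rightarrow> 'v) \<Rightarrow> (nat \<Rightarrow> 'k) \<Rightarrow> 'v \<Rightarrow> 'v" where
  "T0 scale n e c = lin_ext scale n e (\<lambda>i. scale (c i) (e n))"

definition Tk ::
  "('k::field \<Rightarrow> 'v::ab_group_add \<Rightarrow> 'v) \<Rightarrow> nat \<Rightarrow> (nat \<Rightarrow> 'v) \<Rightarrow> nat \<Rightarrow> (nat \<Rightarrow> 'k) \<times> 'k \<Rightarrow> 'v \<Rightarrow> 'v" where
  "Tk scale n e k = (\<lambda>(c, \<alpha>). lin_ext scale n e (\<lambda>i.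
     if i < k then scale (c i) (e n)
     else if i < n then scale (2 ^ (n - i) * \<alpha>) (e i) + scale (c i) (e n)
     else scale (c n) (e n)))"

definition V0 :: "('k::field \<Rightarrow> 'v::ab_group_add \<Rightarrow> 'v) \<Rightarrow> nat \<Rightarrow> (nat \<Rightarrow> 'v) \<Rightarrow> ('v \<Rightarrow> 'v) set" where
  "V0 scale n e = T0 scale n e ` Kn n"

definition Vk ::
  "('k::field \<Rightarrow> 'v::ab_group_add \<Rightarrow> 'v) \<Rightarrow> nat \<Rightarrow> (nat \<Rightarrow> 'v) \<Rightarrow> nat \<Rightarrow> ('v \<Rightarrow> 'v) set" where
  "Vk scale n e k = Tk scale n e k ` (Kn n \<times> (UNIV - {0}))"

end

theory Submission
  imports
    Defs
    "HOL-Computational_Algebra.Polynomial"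
    "HOL-Library.FuncSet"
begin

text \<open>
  Evaluate the Rota--Baxter identity for \<open>R\<close> on pairs of basis vectors, and let \<open>\<lambda>\<^sub>i\<close> be the \<open>e i\<close>-coordinate of
  \<open>R (e i)\<close>. The squares of \<open>e 1, \<dots>, e (n - 1)\<close> are triangular, hence independent. If \<open>\<lambda>\<^sub>i = 0\<close>, the identity
  on the pair \<open>(i, i)\<close> therefore leaves only a multiple of \<open>e n\<close> in \<open>R (e i)\<close>. If \<open>\<lambda>\<^sub>i \<noteq> 0\<close> and \<open>i < n\<close>, it gives
  \<open>\<lambda>\<^sub>i = 2 \<lambda>\<^sub>i\<^sub>+\<^sub>1\<close> by descending induction on \<open>i\<close>, the pairs \<open>(i, j)\<close> with \<open>i < j < n\<close> remove all other coordinates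
  but the last, and every \<open>a i j\<close> with \<open>i + 1 < j < n\<close> has to vanish. So from the first nonzero eigenvalue on,
  \<open>\<lambda>\<^sub>i = 2 ^ (n - i) * \<alpha>\<close>, and this first index exceeds the obstruction index. The shape of \<open>R (e i)\<close> is inherited
  by local operators, and comparison at the single vector \<open>e 1 + \<dots> + e n\<close> transfers the pattern of eigenvalues; this
  is one inclusion (\<open>LRB0_imp_T\<close>). Conversely, the \<open>e n\<close>-component of the value at one vector is a single scalar,
  and a Rota--Baxter operator that agrees with the given one in the other components of that value has a free
  coefficient to adjust it (\<open>T_in_LRB0\<close>).

  For the geometry, the parametrisations \<open>T0\<close> and \<open>Tk\<close> are polynomial embeddings of affine spaces: they have
  polynomial left inverses that read the parameters off the matrix. Such an embedding carries closed sets to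
  closed sets and irreducible sets to irreducible sets (\<open>polynomial_embedding_closed_image\<close>,
  \<open>polynomial_map_irreducible_image\<close>). For each \<open>k\<close>, the parameters with \<open>\<alpha> = 0\<close> are mapped onto
  \<open>V0\<close>; so \<open>Vk \<union> V0\<close> is a closed linear space, irreducible, and \<open>Vk\<close> is its nonempty
  open complement of \<open>V0\<close>.

  Irreducibility comes from joining two points of a set by a line that leaves the set at finitely many parameters only,
  since a nonzero univariate polynomial over an infinite field has finitely many roots. The dimension of an image of \<open>m\<close>-space is
  at most \<open>m\<close> by counting: along a chain \<open>Z 0 \<subset> \<dots> \<subset> Z r\<close> pick polynomials \<open>p i\<close> that vanish on \<open>Z i\<close> but not on
  \<open>Z (Suc i)\<close>. They are algebraically independent on \<open>Z r\<close> (\<open>chain_monomials_independent\<close>), so the \<open>N ^ r\<close>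
  monomials with exponents below \<open>N\<close> are independent, whereas they lie in a space whose dimension is bounded by a polynomial in
  \<open>N\<close> of degree \<open>m\<close>. Coordinate flags give chains of the required length.
\<close>

section \<open>Irreducible sets\<close>

text \<open>Irreducibility in terms of closed sets of the ambient space, so that no subspace topology has to be
  unfolded later.\<close>
lemma irreducible_in_iff:
  "irreducible_in X S \<longleftrightarrow> S \<subseteq> topspace X \<and> S \<noteq> {} \<and>
     (\<forall>C D. closedin X C \<longrightarrow> closedin X D \<longrightarrow> S \<subseteq> C \<union> D \<longrightarrow> S \<subseteq> C \<or> S \<subseteq> D)"
proof (cases "S \<subseteq> topspace X")
  case True
  then have top: "topspace (subtopology X S) = S" by auto
  have "(\<forall>A B. closedin (subtopology X S) A \<longrightarrow> closedin (subtopology X S) B \<longrightarrow>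
           A \<union> B = S \<longrightarrow> A = S \<or> B = S) \<longleftrightarrow>
        (\<forall>C D. closedin X C \<longrightarrow> closedin X D \<longrightarrow> S \<subseteq> C \<union> D \<longrightarrow> S \<subseteq> C \<or> S \<subseteq> D)"
    (is "?L \<longleftrightarrow> ?R")
  proof
    assume L: ?L
    show ?R
    proof (intro allI impI)
      fix C D assume "closedin X C" "closedin X D" "S \<subseteq> C \<union> D"
      then have "C \<inter> S = S \<or> D \<inter> S = S"
        using L[rule_format, of "C \<inter> S" "D \<inter> S"] by (auto simp: closedin_subtopology)
      then show "S \<subseteq> C \<or> S \<subseteq> D" by auto
    qed
  next
    assume R: ?R
    show ?L
    proof (intro allI impI)
      fix A B
      assume "closedin (subtopology X S) A" "closedin (subtopology X S) B" "A \<union> B = S"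
      then obtain C D where "closedin X C" "A = C \<inter> S" "closedin X D" "B = D \<inter> S"
        unfolding closedin_subtopology by blast
      then show "A = S \<or> B = S" using R[rule_format, of C D] \<open>A \<union> B = S\<close> by blast
    qed
  qed
  then show ?thesis using True top by (simp add: irreducible_in_def irreducible_space_def)
qed (simp add: irreducible_in_def)

lemma irreducible_in_subset_cases:
  assumes "irreducible_in X S" "closedin X C" "closedin X D" "S \<subseteq> C \<union> D"
  shows "S \<subseteq> C \<or> S \<subseteq> D"
  using assms(1)[unfolded irreducible_in_iff] assms(2-4) by blast

lemma irreducible_in_subtopology:
  "irreducible_in (subtopology X S) Z \<longleftrightarrow> irreducible_in X Z \<and> Z \<subseteq> S"
  by (auto simp: irreducible_in_def subtopology_subtopology Int_absorb1 inf.absorb2)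

lemma closedin_subset_subtopology: "closedin X C \<Longrightarrow> C \<subseteq> S \<Longrightarrow> closedin (subtopology X S) C"
  by (auto simp: closedin_subtopology)

lemma irreducible_in_continuous_image:
  assumes "irreducible_in X S" "continuous_map X Y f"
  shows "irreducible_in Y (f ` S)"
  unfolding irreducible_in_iff
proof (intro conjI allI impI)
  show "f ` S \<subseteq> topspace Y"
    using assms by (auto simp: irreducible_in_def continuous_map_def)
  show "f ` S \<noteq> {}" using assms(1) by (simp add: irreducible_in_iff)
  fix C D assume CD: "closedin Y C" "closedin Y D" "f ` S \<subseteq> C \<union> D"
  let ?pre = "\<lambda>C. {x \<in> topspace X. f x \<in> C}"
  have "closedin X (?pre C)" "closedin X (?pre D)"
    using CD(1,2)[THEN closedin_continuous_map_preimage[OF assms(2)]] by simp_all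
  moreover have "S \<subseteq> ?pre C \<union> ?pre D" using CD(3) assms(1) by (auto simp: irreducible_in_def)
  ultimately have "S \<subseteq> ?pre C \<or> S \<subseteq> ?pre D"
    by (rule irreducible_in_subset_cases[OF assms(1)])
  then show "f ` S \<subseteq> C \<or> f ` S \<subseteq> D" by blast
qed

text \<open>This reduces a dimension bound for a finite union of closed sets to a bound for each of them: the top member
  of a chain lies in one of the sets.\<close>
lemma irreducible_in_finite_cover:
  assumes "finite F" "\<And>C. C \<in> F \<Longrightarrow> closedin X C" "irreducible_in X Z" "Z \<subseteq> \<Union>F"
  shows "\<exists>C\<in>F. Z \<subseteq> C"
  using assms
proof (induction F rule: finite_induct)
  case empty
  then show ?case by (simp add: irreducible_in_iff)
next
  case (insert C F)
  then have "closedin X (\<Union>F)" by (intro closedin_Union) auto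
  then have "Z \<subseteq> C \<or> Z \<subseteq> \<Union>F"
    using insert.prems by (intro irreducible_in_subset_cases[of X]) auto
  then show ?case
  proof
    assume "Z \<subseteq> \<Union>F"
    then have "\<exists>C\<in>F. Z \<subseteq> C" by (intro insert.IH) (use insert.prems in auto)
    then show ?case by simp
  qed simp
qed

lemma krull_dim_ge_chain:
  assumes "\<And>i. i \<le> r \<Longrightarrow> closedin X (Z i) \<and> irreducible_in X (Z i)"
    and "\<And>i. i < r \<Longrightarrow> Z i \<subset> Z (Suc i)"
  shows "enat r \<le> krull_dim X"
  unfolding krull_dim_def using assms by (intro Sup_upper) blast

lemma krull_dim_le_chain:
  assumes "\<And>r Z. (\<And>i. i \<le> r \<Longrightarrow> closedin X (Z i) \<and> irreducible_in X (Z i)) \<Longrightarrow>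
     (\<And>i. i < r \<Longrightarrow> Z i \<subset> Z (Suc i)) \<Longrightarrow> r \<le> d"
  shows "krull_dim X \<le> enat d"
  unfolding krull_dim_def
proof (rule Sup_least, clarify)
  fix r and Z :: "nat \<Rightarrow> 'a set"
  assume "\<forall>i\<le>r. closedin X (Z i) \<and> irreducible_in X (Z i)" "\<forall>i<r. Z i \<subset> Z (Suc i)"
  then show "enat r \<le> enat d" using assms[of r Z] by simp
qed

section \<open>Polynomial functions and polynomial maps\<close>

lemma poly_funs_uminus: "f \<in> poly_funs A \<Longrightarrow> (\<lambda>x. - f x) \<in> poly_funs A"
  using poly_funs.mult[OF poly_funs.const[of "-1" A], of f] by simp

lemma poly_funs_diff: "f \<in> poly_funs A \<Longrightarrow> g \<in> poly_funs A \<Longrightarrow> (\<lambda>x. f x - g x) \<in> poly_funs A"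
  using poly_funs.add[OF _ poly_funs_uminus, of f A g] by simp

lemma poly_funs_sum:
  "(\<And>i. i \<in> I \<Longrightarrow> f i \<in> poly_funs A) \<Longrightarrow> (\<lambda>x. \<Sum>i\<in>I. f i x) \<in> poly_funs A"
  by (induction I rule: infinite_finite_induct) (simp_all add: poly_funs.const poly_funs.add)

lemma poly_funs_prod:
  "(\<And>i. i \<in> I \<Longrightarrow> f i \<in> poly_funs A) \<Longrightarrow> (\<lambda>x. \<Prod>i\<in>I. f i x) \<in> poly_funs A"
  by (induction I rule: infinite_finite_induct) (simp_all add: poly_funs.const poly_funs.mult)

lemma poly_funs_power: "f \<in> poly_funs A \<Longrightarrow> (\<lambda>x. f x ^ m) \<in> poly_funs A"
  by (induction m) (simp_all add: poly_funs.const poly_funs.mult)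

text \<open>Composition with \<open>\<phi>\<close> is a ring homomorphism, so it suffices to look at coordinate functions. The set
  \<open>S\<close> lets a function be replaced by one that agrees with it on a subset only.\<close>
lemma poly_funs_pullback:
  assumes "f \<in> poly_funs B"
    and "\<And>g. g \<in> coords B \<Longrightarrow> \<exists>h\<in>poly_funs A. \<forall>x\<in>S. g (\<phi> x) = h x"
  shows "\<exists>h\<in>poly_funs A. \<forall>x\<in>S. f (\<phi> x) = h x"
  using assms(1)
proof induction
  case (add f g)
  obtain h where h: "h \<in> poly_funs A" "\<forall>x\<in>S. f (\<phi> x) = h x" using add.IH(1) ..
  obtain k where k: "k \<in> poly_funs A" "\<forall>x\<in>S. g (\<phi> x) = k x" using add.IH(2) ..
  show ?case by (intro bexI[of _ "\<lambda>x. h x + k x"] poly_funs.add h k) (simp add: h k)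
next
  case (mult f g)
  obtain h where h: "h \<in> poly_funs A" "\<forall>x\<in>S. f (\<phi> x) = h x" using mult.IH(1) ..
  obtain k where k: "k \<in> poly_funs A" "\<forall>x\<in>S. g (\<phi> x) = k x" using mult.IH(2) ..
  show ?case by (intro bexI[of _ "\<lambda>x. h x * k x"] poly_funs.mult h k) (simp add: h k)
next
  case (const a)
  show ?case by (intro bexI[of _ "\<lambda>_. a"] poly_funs.const) simp
next
  case (coord g)
  then show ?case by (rule assms(2))
qed

text \<open>Coordinates are required to agree with polynomial functions on the points of \<open>A\<close> only: maps are total
  functions in the logic, and their values elsewhere are arbitrary.\<close>
definition polynomial_map ::
  "('x, 'k::field) affine_space \<Rightarrow> ('y, 'k) affine_space \<Rightarrow> ('x \<Rightarrow> 'y) \<Rightarrow> bool" where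
  "polynomial_map A B \<phi> \<longleftrightarrow> \<phi> ` points A \<subseteq> points B \<and>
     (\<forall>g\<in>coords B. \<exists>h\<in>poly_funs A. \<forall>x\<in>points A. g (\<phi> x) = h x)"

lemma polynomial_map_in_points: "polynomial_map A B \<phi> \<Longrightarrow> x \<in> points A \<Longrightarrow> \<phi> x \<in> points B"
  by (auto simp: polynomial_map_def)

lemma polynomial_map_pullback:
  assumes "polynomial_map A B \<phi>" "f \<in> poly_funs B"
  obtains h where "h \<in> poly_funs A" "\<And>x. x \<in> points A \<Longrightarrow> f (\<phi> x) = h x"
proof -
  have "\<exists>h\<in>poly_funs A. \<forall>x\<in>points A. f (\<phi> x) = h x"
    by (rule poly_funs_pullback[OF assms(2)]) (use assms(1) in \<open>simp add: polynomial_map_def\<close>)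
  then obtain h where "h \<in> poly_funs A" "\<forall>x\<in>points A. f (\<phi> x) = h x" ..
  then show thesis by (intro that[of h]) simp_all
qed

lemma polynomial_map_comp:
  assumes \<phi>: "polynomial_map A B \<phi>" and \<psi>: "polynomial_map B C \<psi>"
  shows "polynomial_map A C (\<lambda>x. \<psi> (\<phi> x))"
  unfolding polynomial_map_def
proof (intro conjI ballI)
  show "(\<lambda>x. \<psi> (\<phi> x)) ` points A \<subseteq> points C"
    by (intro image_subsetI polynomial_map_in_points[OF \<psi>] polynomial_map_in_points[OF \<phi>])
  fix g assume g: "g \<in> coords C"
  obtain h where h: "h \<in> poly_funs B" "\<And>y. y \<in> points B \<Longrightarrow> g (\<psi> y) = h y"
    by (rule polynomial_map_pullback[OF \<psi> poly_funs.coord[OF g]]) (rule that; simp)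
  obtain k where k: "k \<in> poly_funs A" "\<And>x. x \<in> points A \<Longrightarrow> h (\<phi> x) = k x"
    by (rule polynomial_map_pullback[OF \<phi> h(1)]) (rule that; simp)
  show "\<exists>h\<in>poly_funs A. \<forall>x\<in>points A. g (\<psi> (\<phi> x)) = h x"
    by (intro bexI[of _ k] ballI k(1)) (simp add: h(2) k(2) polynomial_map_in_points[OF \<phi>])
qed

lemma closedin_zariski_zeros:
  "p \<in> poly_funs A \<Longrightarrow> closedin (zariski A) {x \<in> points A. p x = 0}"
  unfolding closedin_zariski zero_locus_def by (intro exI[of _ "{p}"]) auto

lemma closedin_zariski_separates:
  assumes "closedin (zariski A) C" "x \<in> points A" "x \<notin> C"
  obtains p where "p \<in> poly_funs A" "p x \<noteq> 0" "\<forall>y\<in>C. p y = 0"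
proof -
  obtain P where P: "P \<subseteq> poly_funs A" "C = zero_locus A P"
    using assms(1) unfolding closedin_zariski by (elim exE conjE)
  with assms(2,3) obtain p where "p \<in> P" "p x \<noteq> 0" by (auto simp: zero_locus_def)
  with P show thesis by (intro that[of p]) (auto simp: zero_locus_def)
qed

lemma polynomial_map_continuous:
  assumes "polynomial_map A B \<phi>"
  shows "continuous_map (zariski A) (zariski B) \<phi>"
  unfolding continuous_map_closedin
proof (intro conjI allI impI)
  show map: "\<phi> \<in> topspace (zariski A) \<rightarrow> topspace (zariski B)"
    using assms by (auto simp: polynomial_map_def)
  fix C assume C: "closedin (zariski B) C"
  let ?pre = "{x \<in> topspace (zariski A). \<phi> x \<in> C}"
  let ?P = "{p \<in> poly_funs A. \<forall>x\<in>?pre. p x = 0}"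
  have "?pre = zero_locus A ?P"
  proof (intro equalityI subsetI)
    fix x assume x: "x \<in> zero_locus A ?P"
    then have xA: "x \<in> points A" by (simp add: zero_locus_def)
    show "x \<in> ?pre"
    proof (rule ccontr)
      assume "x \<notin> ?pre"
      then have \<phi>x: "\<phi> x \<in> points B" "\<phi> x \<notin> C" using xA map by auto
      obtain p where p: "p \<in> poly_funs B" "p (\<phi> x) \<noteq> 0" "\<forall>y\<in>C. p y = 0"
        using closedin_zariski_separates[OF C \<phi>x] .
      obtain h where h: "h \<in> poly_funs A" "\<And>x. x \<in> points A \<Longrightarrow> p (\<phi> x) = h x"
        by (rule polynomial_map_pullback[OF assms p(1)]) (rule that; simp)
      have "h y = 0" if "y \<in> ?pre" for y using that h(2)[of y] p(3) by simp
      then have "h \<in> ?P" using h(1) by blast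
      then have "h x = 0" using x unfolding zero_locus_def by blast
      then show False using h(2)[OF xA] p(2) by simp
    qed
  qed (auto simp: zero_locus_def)
  moreover have "?P \<subseteq> poly_funs A" by auto
  ultimately show "closedin (zariski A) ?pre" unfolding closedin_zariski by (intro exI[of _ ?P] conjI)
qed

lemma regular_fun_if_polynomial:
  assumes "S \<subseteq> points A" "h \<in> poly_funs A" "\<And>x. x \<in> S \<Longrightarrow> f x = h x"
  shows "regular_fun A S f"
  unfolding regular_fun_def
proof
  fix x assume x: "x \<in> S"
  have "openin (subtopology (zariski A) S) S" using openin_topspace[of "subtopology (zariski A) S"] assms(1)
    by (simp add: Int_absorb1)
  then show "\<exists>U. openin (subtopology (zariski A) S) U \<and> x \<in> U \<and>
     (\<exists>p\<in>poly_funs A. \<exists>q\<in>poly_funs A. \<forall>y\<in>U. q y \<noteq> 0 \<and> f y = p y / q y)"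
    by (intro exI[of _ S] conjI x bexI[of _ h] bexI[of _ "\<lambda>_. 1"] ballI poly_funs.const assms(2))
      (simp_all add: assms(3))
qed

lemma regular_map_if_polynomial_map:
  assumes "polynomial_map A B \<phi>" "S \<subseteq> points A" "\<phi> ` S \<subseteq> T" "\<And>x. x \<in> S \<Longrightarrow> \<phi>' x = \<phi> x"
  shows "regular_map A S B T \<phi>'"
  unfolding regular_map_def
proof (intro conjI ballI)
  show "\<phi>' ` S \<subseteq> T" using assms(3,4) by auto
  fix g assume "g \<in> coords B"
  then obtain h where "h \<in> poly_funs A" "\<And>x. x \<in> points A \<Longrightarrow> g (\<phi> x) = h x"
    by (rule polynomial_map_pullback[OF assms(1) poly_funs.coord]) (rule that; simp)
  then show "regular_fun A S (g \<circ> \<phi>')"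
    using assms(2,4) by (intro regular_fun_if_polynomial[of S A h]) (simp_all add: subset_iff)
qed

text \<open>A polynomial map with a polynomial left inverse. All the parametrisations of strata are of this kind.\<close>
definition polynomial_embedding ::
  "('x, 'k::field) affine_space \<Rightarrow> ('y, 'k) affine_space \<Rightarrow> ('x \<Rightarrow> 'y) \<Rightarrow> ('y \<Rightarrow> 'x) \<Rightarrow> bool" where
  "polynomial_embedding A B \<phi> \<psi> \<longleftrightarrow> polynomial_map A B \<phi> \<and> polynomial_map B A \<psi> \<and>
     (\<forall>x\<in>points A. \<psi> (\<phi> x) = x)"

lemma polynomial_embedding_inj_on:
  "polynomial_embedding A B \<phi> \<psi> \<Longrightarrow> inj_on \<phi> (points A)"
  unfolding polynomial_embedding_def by (auto intro: inj_on_inverseI)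

lemma polynomial_embedding_variety_iso:
  assumes emb: "polynomial_embedding A B \<phi> \<psi>" and S: "S \<subseteq> points A"
  shows "variety_iso A S B (\<phi> ` S) \<phi>"
  unfolding variety_iso_def
proof (intro conjI)
  have inj: "inj_on \<phi> S" using polynomial_embedding_inj_on[OF emb] S by (rule inj_on_subset)
  then show "bij_betw \<phi> S (\<phi> ` S)" by (rule inj_on_imp_bij_betw)
  show "regular_map A S B (\<phi> ` S) \<phi>"
    using emb S by (intro regular_map_if_polynomial_map) (auto simp: polynomial_embedding_def)
  show "regular_map B (\<phi> ` S) A S (inv_into S \<phi>)"
  proof (rule regular_map_if_polynomial_map)
    show "polynomial_map B A \<psi>" "\<phi> ` S \<subseteq> points B"
      using emb S by (auto simp: polynomial_embedding_def polynomial_map_def)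
    show "\<psi> ` \<phi> ` S \<subseteq> S" using emb S by (auto simp: polynomial_embedding_def subset_iff)
    show "inv_into S \<phi> y = \<psi> y" if "y \<in> \<phi> ` S" for y
    proof -
      from that obtain x where x: "x \<in> S" "y = \<phi> x" by blast
      then show ?thesis using emb S inj by (simp add: polynomial_embedding_def subset_iff)
    qed
  qed
qed

text \<open>The image of \<open>C\<close> consists of the points \<open>y\<close> with \<open>\<psi> y \<in> C\<close> that are fixed by \<open>\<phi> \<circ> \<psi>\<close>. Being
  fixed is a system of polynomial equations because the coordinates separate points.\<close>
lemma polynomial_embedding_closed_image:
  assumes emb: "polynomial_embedding A B \<phi> \<psi>" and C: "closedin (zariski A) C"
    and sep: "\<And>x y. x \<in> points B \<Longrightarrow> y \<in> points B \<Longrightarrow> (\<And>g. g \<in> coords B \<Longrightarrow> g x = g y) \<Longrightarrow> x = y"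
  shows "closedin (zariski B) (\<phi> ` C)"
proof -
  have maps: "polynomial_map A B \<phi>" "polynomial_map B A \<psi>"
    and inv: "\<And>x. x \<in> points A \<Longrightarrow> \<psi> (\<phi> x) = x"
    using emb by (auto simp: polynomial_embedding_def)
  have CA: "C \<subseteq> points A" using closedin_subset[OF C] by simp
  have range: "\<phi> x \<in> points B" if "x \<in> points A" for x
    using polynomial_map_in_points[OF maps(1) that] .
  let ?fix = "{y \<in> points B. \<forall>g\<in>coords B. g y - g (\<phi> (\<psi> y)) = 0}"
  have "\<exists>h\<in>poly_funs B. \<forall>y\<in>points B. h y = g y - g (\<phi> (\<psi> y))" if g: "g \<in> coords B" for g
  proof -
    obtain h where "h \<in> poly_funs B" "\<And>y. y \<in> points B \<Longrightarrow> g (\<phi> (\<psi> y)) = h y"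
      by (rule polynomial_map_pullback[OF polynomial_map_comp[OF maps(2,1)] poly_funs.coord[OF g]])
        (rule that; simp)
    then show ?thesis
      by (intro bexI[of _ "\<lambda>y. g y - h y"] poly_funs_diff poly_funs.coord[OF g]) auto
  qed
  then obtain h where h: "\<And>g. g \<in> coords B \<Longrightarrow> h g \<in> poly_funs B \<and>
      (\<forall>y\<in>points B. h g y = g y - g (\<phi> (\<psi> y)))" by metis
  then have "?fix = {y \<in> points B. \<forall>g\<in>coords B. h g y = 0}" by (intro Collect_cong) auto
  then have "?fix = zero_locus B (h ` coords B)" by (simp add: zero_locus_def)
  moreover have "h ` coords B \<subseteq> poly_funs B" using h by auto
  ultimately have fix_closed: "closedin (zariski B) ?fix"
    unfolding closedin_zariski by (intro exI[of _ "h ` coords B"] conjI)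
  have "closedin (zariski B) {y \<in> topspace (zariski B). \<psi> y \<in> C}"
    by (rule closedin_continuous_map_preimage[OF polynomial_map_continuous[OF maps(2)] C])
  moreover have "\<phi> ` C = ?fix \<inter> {y \<in> topspace (zariski B). \<psi> y \<in> C}"
  proof (intro equalityI subsetI)
    fix y assume "y \<in> \<phi> ` C"
    then show "y \<in> ?fix \<inter> {y \<in> topspace (zariski B). \<psi> y \<in> C}"
      using CA range inv by auto
  next
    fix y assume y: "y \<in> ?fix \<inter> {y \<in> topspace (zariski B). \<psi> y \<in> C}"
    then have "y = \<phi> (\<psi> y)" using CA range by (intro sep) auto
    then show "y \<in> \<phi> ` C" using y by blast
  qed
  ultimately show ?thesis using closedin_Int[OF fix_closed] by simp
qed

lemma polynomial_map_irreducible_image: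
  "polynomial_map A B \<phi> \<Longrightarrow> irreducible_in (zariski A) S \<Longrightarrow> irreducible_in (zariski B) (\<phi> ` S)"
  using irreducible_in_continuous_image polynomial_map_continuous by blast

section \<open>Irreducibility along curves\<close>

lemma poly_funs_on_curve:
  fixes \<gamma> :: "'k::field \<Rightarrow> 'x"
  assumes "f \<in> poly_funs A" "\<And>g. g \<in> coords A \<Longrightarrow> \<exists>q. \<forall>t. g (\<gamma> t) = poly q t"
  shows "\<exists>q. \<forall>t. f (\<gamma> t) = poly q t"
  using assms(1)
proof induction
  case (const a)
  show ?case by (intro exI[of _ "[:a:]"]) simp
next
  case (add f g)
  then show ?case by (metis poly_add)
next
  case (mult f g)
  then show ?case by (metis poly_mult)
next
  case (coord g)
  then show ?case by (rule assms(2))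
qed

text \<open>If closed sets \<open>C\<close>, \<open>D\<close> cover \<open>S\<close> and miss \<open>x\<close> and \<open>y\<close> respectively, take functions vanishing on \<open>C\<close>
  and on \<open>D\<close> but not at \<open>x\<close>, respectively \<open>y\<close>. Along a curve from \<open>x\<close> to \<open>y\<close> their product is a nonzero
  polynomial in one variable that vanishes at all but finitely many parameters, which is impossible
  over an infinite field.\<close>
lemma irreducible_in_if_curve_connected:
  fixes A :: "('x, 'k::field_char_0) affine_space"
  assumes S: "S \<subseteq> points A" "S \<noteq> {}"
    and curve: "\<And>x y. x \<in> S \<Longrightarrow> y \<in> S \<Longrightarrow> \<exists>\<gamma> :: 'k \<Rightarrow> 'x. \<gamma> 0 = x \<and> \<gamma> 1 = y \<and>
       finite {t. \<gamma> t \<notin> S} \<and> (\<forall>g\<in>coords A. \<exists>q. \<forall>t. g (\<gamma> t) = poly q t)"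
  shows "irreducible_in (zariski A) S"
  unfolding irreducible_in_iff
proof (intro conjI allI impI)
  fix C D assume CD: "closedin (zariski A) C" "closedin (zariski A) D" "S \<subseteq> C \<union> D"
  show "S \<subseteq> C \<or> S \<subseteq> D"
  proof (rule ccontr)
    assume "\<not> ?thesis"
    then obtain x y where xy: "x \<in> S" "x \<notin> C" "y \<in> S" "y \<notin> D" by blast
    obtain f where f: "f \<in> poly_funs A" "f x \<noteq> 0" "\<forall>z\<in>C. f z = 0"
      using closedin_zariski_separates[OF CD(1) subsetD[OF S(1) xy(1)] xy(2)] .
    obtain g where g: "g \<in> poly_funs A" "g y \<noteq> 0" "\<forall>z\<in>D. g z = 0"
      using closedin_zariski_separates[OF CD(2) subsetD[OF S(1) xy(3)] xy(4)] .
    obtain \<gamma> :: "'k \<Rightarrow> 'x" where \<gamma>: "\<gamma> 0 = x" "\<gamma> 1 = y" "finite {t. \<gamma> t \<notin> S}"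
      "\<And>g. g \<in> coords A \<Longrightarrow> \<exists>q. \<forall>t. g (\<gamma> t) = poly q t"
      using curve[OF xy(1,3)] by auto
    obtain p where p: "\<And>t. f (\<gamma> t) = poly p t" using poly_funs_on_curve[where \<gamma> = \<gamma>, OF f(1) \<gamma>(4)] by auto
    obtain q where q: "\<And>t. g (\<gamma> t) = poly q t" using poly_funs_on_curve[where \<gamma> = \<gamma>, OF g(1) \<gamma>(4)] by auto
    have "p * q \<noteq> 0" using f(2) g(2) p[of 0] q[of 1] \<gamma>(1,2) by auto
    moreover have "poly (p * q) t = 0" if "\<gamma> t \<in> S" for t
      using that CD(3) f(3) g(3) p[of t] q[of t] by auto
    then have "UNIV \<subseteq> {t. \<gamma> t \<notin> S} \<union> {t. poly (p * q) t = 0}" by auto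
    ultimately show False
      using \<gamma>(3) poly_roots_finite[of "p * q"] infinite_UNIV_char_0[where 'a='k]
        finite_subset[of UNIV] by (metis finite_UnI)
  qed
qed (use S in auto)

text \<open>The coordinate ring of an irreducible set has no zero divisors.\<close>
lemma irreducible_in_domain:
  assumes "irreducible_in (zariski A) Z" "f \<in> poly_funs A" "g \<in> poly_funs A"
    and "\<And>x. x \<in> Z \<Longrightarrow> f x * g x = 0"
  shows "(\<forall>x\<in>Z. f x = 0) \<or> (\<forall>x\<in>Z. g x = 0)"
proof -
  have "Z \<subseteq> {x \<in> points A. f x = 0} \<union> {x \<in> points A. g x = 0}"
    using assms(1,4) by (auto simp: irreducible_in_def)
  then have "Z \<subseteq> {x \<in> points A. f x = 0} \<or> Z \<subseteq> {x \<in> points A. g x = 0}"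
    by (rule irreducible_in_subset_cases[OF assms(1) closedin_zariski_zeros[OF assms(2)]
          closedin_zariski_zeros[OF assms(3)]])
  then show ?thesis by blast
qed

section \<open>Length of chains of irreducible closed sets\<close>

text \<open>Splits off the exponent of the last variable.\<close>
lemma sum_exponents_Suc:
  fixes f :: "(nat \<Rightarrow> nat) \<Rightarrow> 'a::comm_monoid_add"
  shows "(\<Sum>a\<in>PiE {..<Suc r} (\<lambda>_. {..<N}). f a) =
    (\<Sum>j<N. \<Sum>b\<in>PiE {..<r} (\<lambda>_. {..<N}). f (b(r := j)))"
proof -
  have "PiE {..<Suc r} (\<lambda>_. {..<N}) =
      (\<lambda>(j, b). b(r := j)) ` ({..<N} \<times> PiE {..<r} (\<lambda>_. {..<N}))"
    by (simp add: lessThan_Suc PiE_insert_eq)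
  moreover have "inj_on (\<lambda>(j, b). b(r := j)) ({..<N} \<times> PiE {..<r} (\<lambda>_. {..<N}))"
    using inj_combinator[of r "{..<r}" "\<lambda>_. {..<N}"] by simp
  ultimately show ?thesis
    by (simp add: sum.reindex sum.cartesian_product case_prod_unfold)
qed

text \<open>View a relation on \<open>Z (Suc r)\<close> as a polynomial in \<open>p r\<close> whose coefficients are polynomials in the earlier
  functions. Its lowest power of \<open>p r\<close> can be cancelled, as the coordinate ring is a domain and \<open>p r\<close> is nonzero
  there. Restriction to \<open>Z r\<close>, where \<open>p r\<close> vanishes, then leaves only the lowest coefficient, which is zero by
  induction on \<open>r\<close>. Hence all coefficients vanish one after the other.\<close>
lemma chain_monomials_independent:
  assumes irr: "\<And>i. i \<le> r \<Longrightarrow> irreducible_in (zariski A) (Z i)"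
    and sub: "\<And>i. i < r \<Longrightarrow> Z i \<subseteq> Z (Suc i)"
    and p: "\<And>i. i < r \<Longrightarrow> p i \<in> poly_funs A"
    and van: "\<And>i x. i < r \<Longrightarrow> x \<in> Z i \<Longrightarrow> p i x = 0"
    and nonvan: "\<And>i. i < r \<Longrightarrow> \<exists>x\<in>Z (Suc i). p i x \<noteq> 0"
    and rel: "\<And>x. x \<in> Z r \<Longrightarrow>
      (\<Sum>a\<in>PiE {..<r} (\<lambda>_. {..<N}). c a * (\<Prod>i<r. p i x ^ a i)) = 0"
  shows "\<forall>a\<in>PiE {..<r} (\<lambda>_. {..<N}). c a = 0"
  using assms
proof (induction r arbitrary: c)
  case 0
  obtain x where "x \<in> Z 0" using "0.prems"(1)[of 0] by (auto simp: irreducible_in_iff)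
  then show ?case using "0.prems"(6)[of x] by simp
next
  case (Suc r)
  let ?E = "PiE {..<r} (\<lambda>_. {..<N})"
  define q where "q j x = (\<Sum>b\<in>?E. c (b(r := j)) * (\<Prod>i<r. p i x ^ b i))" for j x
  have prod_upd: "(\<Prod>i<Suc r. p i x ^ (b(r := j)) i) = p r x ^ j * (\<Prod>i<r. p i x ^ b i)" for x b j
  proof -
    have "(\<Prod>i<r. p i x ^ (b(r := j)) i) = (\<Prod>i<r. p i x ^ b i)" by (intro prod.cong) auto
    then show ?thesis by (simp add: mult.commute)
  qed
  have rel': "(\<Sum>j<N. p r x ^ j * q j x) = 0" if "x \<in> Z (Suc r)" for x
    using Suc.prems(6)[OF that]
    by (simp only: sum_exponents_Suc prod_upd q_def sum_distrib_left mult.left_commute)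
  have q_poly: "q j \<in> poly_funs A" for j
    unfolding q_def[abs_def]
    by (intro poly_funs_sum poly_funs.mult poly_funs.const poly_funs_prod poly_funs_power Suc.prems(3)) auto
  have pr: "p r \<in> poly_funs A" using Suc.prems(3) by simp
  have coeffs: "\<forall>b\<in>?E. c (b(r := j)) = 0" if "j < N" for j
    using that
  proof (induction j rule: less_induct)
    case (less j)
    \<comment> \<open>The relation divided by \<open>p r ^ j\<close>, which is its lowest remaining power.\<close>
    define s where "s x = (\<Sum>l<N - j. p r x ^ l * q (j + l) x)" for x
    have lower: "q l x = 0" if l: "l < j" for l x
    proof -
      have "l < N" using l less.prems by simp
      then have "c (b(r := l)) * (\<Prod>i<r. p i x ^ b i) = 0" if "b \<in> ?E" for b
        using bspec[OF less.IH[OF l] that] by (simp only: mult_zero_left)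
      then show ?thesis unfolding q_def by (intro sum.neutral ballI)
    qed
    have "p r x ^ j * s x = 0" if "x \<in> Z (Suc r)" for x
    proof -
      have "0 = (\<Sum>l<j + (N - j). p r x ^ l * q l x)" using rel'[OF that] less.prems by simp
      also have "\<dots> = (\<Sum>l<j. p r x ^ l * q l x) + (\<Sum>l<N - j. p r x ^ (j + l) * q (j + l) x)"
        using sum.atLeastLessThan_concat[of 0 j "j + (N - j)" "\<lambda>l. p r x ^ l * q l x"]
          sum.shift_bounds_nat_ivl[of "\<lambda>l. p r x ^ l * q l x" 0 j "N - j"]
        by (simp add: lessThan_atLeast0 add.commute)
      also have "\<dots> = p r x ^ j * s x"
        by (simp add: lower s_def sum_distrib_left power_add mult.assoc)
      finally show ?thesis by simp
    qed
    moreover have "s \<in> poly_funs A"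
      unfolding s_def[abs_def] by (intro poly_funs_sum poly_funs.mult poly_funs_power pr q_poly)
    ultimately have "(\<forall>x\<in>Z (Suc r). p r x ^ j = 0) \<or> (\<forall>x\<in>Z (Suc r). s x = 0)"
      by (intro irreducible_in_domain[OF Suc.prems(1)[of "Suc r"]] poly_funs_power pr) simp_all
    then have s0: "\<forall>x\<in>Z (Suc r). s x = 0" using Suc.prems(5)[of r] by auto
    have "q j x = 0" if x: "x \<in> Z r" for x
    proof -
      have "p r x = 0" using Suc.prems(4)[of r x] x by simp
      then have "s x = (\<Sum>l<N - j. if l = 0 then q j x else 0)"
        unfolding s_def by (intro sum.cong) (auto simp: power_0_left)
      then have "s x = q j x" using less.prems by simp
      then show ?thesis using s0 Suc.prems(2)[of r] x by auto
    qed
    then show ?case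
      using Suc.prems unfolding q_def by (intro Suc.IH[of "\<lambda>b. c (b(r := j))"]) auto
  qed
  show ?case
  proof
    fix a assume "a \<in> PiE {..<Suc r} (\<lambda>_. {..<N})"
    then obtain j b where "j < N" "b \<in> ?E" "a = b(r := j)"
      by (auto simp: lessThan_Suc PiE_insert_eq)
    then show "c a = 0" using coeffs by blast
  qed
qed

interpretation function_space: vector_space
  "fun_scale ((*) :: 'k::field \<Rightarrow> 'k \<Rightarrow> 'k) :: 'k \<Rightarrow> ('x \<Rightarrow> 'k) \<Rightarrow> 'x \<Rightarrow> 'k"
  by (rule vector_space_fun_scale) (simp add: vector_space_def algebra_simps)

lemma sum_pointwise: "(\<Sum>i\<in>I. f i) x = (\<Sum>i\<in>I. f i x)"
  by (induction I rule: infinite_finite_induct) (simp_all add: zero_fun_def plus_fun_def)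

text \<open>The bound \<open>D\<close> applies to each exponent separately and not to the total degree, which makes the monomials
  easy to count.\<close>
definition monomials_upto :: "('x \<Rightarrow> 'k::field) set \<Rightarrow> nat \<Rightarrow> ('x \<Rightarrow> 'k) set" where
  "monomials_upto G D = (\<lambda>b x. \<Prod>g\<in>G. g x ^ b g) ` PiE G (\<lambda>_. {..D})"

definition polys_upto :: "('x \<Rightarrow> 'k::field) set \<Rightarrow> nat \<Rightarrow> ('x \<Rightarrow> 'k) set" where
  "polys_upto G D = function_space.span (monomials_upto G D)"

lemma finite_monomials_upto: "finite G \<Longrightarrow> finite (monomials_upto G D)"
  by (simp add: monomials_upto_def finite_PiE)

lemma card_monomials_upto_le: "finite G \<Longrightarrow> card (monomials_upto G D) \<le> (D + 1) ^ card G"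
  using card_image_le[of "PiE G (\<lambda>_. {..D})" "\<lambda>b x. \<Prod>g\<in>G. g x ^ b g"]
  by (simp add: monomials_upto_def finite_PiE card_PiE)

lemma polys_upto_mono: "D \<le> D' \<Longrightarrow> polys_upto G D \<subseteq> polys_upto G D'"
  unfolding polys_upto_def monomials_upto_def
  by (intro function_space.span_mono image_mono PiE_mono) auto

lemma polys_upto_add: "f \<in> polys_upto G D \<Longrightarrow> g \<in> polys_upto G D \<Longrightarrow> (\<lambda>x. f x + g x) \<in> polys_upto G D"
  unfolding polys_upto_def using function_space.span_add[of f _ g] by (simp add: plus_fun_def)

lemma polys_upto_scale: "f \<in> polys_upto G D \<Longrightarrow> (\<lambda>x. a * f x) \<in> polys_upto G D"
  unfolding polys_upto_def using function_space.span_scale[of f _ a] by (simp add: fun_scale_def)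

lemma polys_upto_zero: "(\<lambda>x. 0) \<in> polys_upto G D"
  unfolding polys_upto_def using function_space.span_zero by (simp add: zero_fun_def)

lemma polys_upto_one: "(\<lambda>x. 1) \<in> polys_upto G D"
  unfolding polys_upto_def monomials_upto_def
  by (intro function_space.span_base image_eqI[of _ _ "\<lambda>g\<in>G. 0"]) auto

lemma monomials_upto_mult:
  assumes "f \<in> monomials_upto G D" "g \<in> monomials_upto G D'"
  shows "(\<lambda>x. f x * g x) \<in> monomials_upto G (D + D')"
proof -
  obtain b b' where b: "b \<in> PiE G (\<lambda>_. {..D})" "f = (\<lambda>x. \<Prod>g\<in>G. g x ^ b g)"
    "b' \<in> PiE G (\<lambda>_. {..D'})" "g = (\<lambda>x. \<Prod>g\<in>G. g x ^ b' g)"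
    using assms unfolding monomials_upto_def by auto
  have "(\<lambda>x. f x * g x) = (\<lambda>x. \<Prod>g\<in>G. g x ^ (\<lambda>g\<in>G. b g + b' g) g)"
    unfolding b prod.distrib[symmetric] by (intro ext prod.cong) (auto simp: power_add)
  moreover have "(\<lambda>g\<in>G. b g + b' g) \<in> PiE G (\<lambda>_. {..D + D'})"
    using b by (auto simp: PiE_iff intro!: add_mono)
  ultimately show ?thesis unfolding monomials_upto_def by (rule image_eqI)
qed

lemma polys_upto_mult:
  assumes f: "f \<in> polys_upto G D" and g: "g \<in> polys_upto G D'"
  shows "(\<lambda>x. f x * g x) \<in> polys_upto G (D + D')"
proof -
  have monom: "(\<lambda>x. f x * m x) \<in> polys_upto G (D + D')" if m: "m \<in> monomials_upto G D'" for m
    using f unfolding polys_upto_def[of G D]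
  proof (induction rule: function_space.span_induct_alt)
    case base
    show ?case using polys_upto_zero by simp
  next
    case (step c f h)
    have "(\<lambda>x. f x * m x) \<in> polys_upto G (D + D')"
      unfolding polys_upto_def using step.hyps m by (intro function_space.span_base monomials_upto_mult)
    from polys_upto_add[OF polys_upto_scale[OF this, of c] step.IH] show ?case
      by (simp add: fun_scale_def algebra_simps)
  qed
  show ?thesis
    using g unfolding polys_upto_def[of G D']
  proof (induction rule: function_space.span_induct_alt)
    case base
    show ?case using polys_upto_zero by simp
  next
    case (step c m h)
    from polys_upto_add[OF polys_upto_scale[OF monom[OF step.hyps(1)], of c] step.IH] show ?case
      by (simp add: fun_scale_def algebra_simps)
  qed
qed

lemma polys_upto_power: "f \<in> polys_upto G D \<Longrightarrow> (\<lambda>x. f x ^ m) \<in> polys_upto G (m * D)"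
  by (induction m) (simp_all add: polys_upto_one polys_upto_mult)

lemma polys_upto_prod:
  assumes "\<And>i. i < r \<Longrightarrow> f i \<in> polys_upto G D"
  shows "(\<lambda>x. \<Prod>i<r. f i x) \<in> polys_upto G (r * D)"
  using assms
proof (induction r)
  case (Suc r)
  then have "(\<lambda>x. (\<Prod>i<r. f i x) * f r x) \<in> polys_upto G (r * D + D)"
    by (intro polys_upto_mult) auto
  then show ?case by (simp add: add.commute)
qed (simp add: polys_upto_one)

lemma poly_funs_in_polys_upto:
  assumes "finite (coords B)" "f \<in> poly_funs B"
  shows "\<exists>D. f \<in> polys_upto (coords B) D"
  using assms(2)
proof induction
  case (const a)
  show ?case using polys_upto_scale[OF polys_upto_one, of a] by auto
next
  case (coord g)
  let ?b = "\<lambda>h\<in>coords B. if h = g then 1 else 0 :: nat"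
  have "(\<Prod>h\<in>coords B. h x ^ ?b h) = (\<Prod>h\<in>coords B. if h = g then g x else 1)" for x
    by (intro prod.cong) auto
  then have "g = (\<lambda>x. \<Prod>h\<in>coords B. h x ^ ?b h)" using assms(1) coord by simp
  moreover have "?b \<in> PiE (coords B) (\<lambda>_. {..1})" by auto
  ultimately have "g \<in> monomials_upto (coords B) 1" unfolding monomials_upto_def by (rule image_eqI)
  then show ?case unfolding polys_upto_def by (blast intro: function_space.span_base)
next
  case (add f g)
  then obtain D D' where "f \<in> polys_upto (coords B) D" "g \<in> polys_upto (coords B) D'" by blast
  then have "f \<in> polys_upto (coords B) (max D D')" "g \<in> polys_upto (coords B) (max D D')"
    using polys_upto_mono max.cobounded1 max.cobounded2 by blast+
  from polys_upto_add[OF this] show ?case by (rule exI)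
next
  case (mult f g)
  then obtain D D' where "f \<in> polys_upto (coords B) D" "g \<in> polys_upto (coords B) D'" by blast
  from polys_upto_mult[OF this] show ?case by (rule exI)
qed

text \<open>Compares the growth in \<open>N\<close>: the left side has degree \<open>r\<close>, the right side degree \<open>m\<close>.\<close>
lemma exponent_le_if_power_bound:
  fixes r m K :: nat
  assumes "\<And>N. N \<ge> 1 \<Longrightarrow> N ^ r \<le> (K * N + 1) ^ m"
  shows "r \<le> m"
proof (rule ccontr)
  assume "\<not> r \<le> m"
  \<comment> \<open>\<open>K * N + 1\<close> is at most \<open>(K + 1) * N\<close>, so \<open>N\<close> only has to exceed the constant \<open>(K + 1) ^ m\<close>.\<close>
  define N where "N = (K + 1) ^ m + 1"
  have N: "N \<ge> 1" by (simp add: N_def)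
  have "N ^ Suc m \<le> N ^ r" using \<open>\<not> r \<le> m\<close> N by (intro power_increasing) auto
  also have "\<dots> \<le> (K * N + 1) ^ m" by (rule assms[OF N])
  also have "\<dots> \<le> ((K + 1) * N) ^ m" using N by (intro power_mono) auto
  also have "\<dots> = (K + 1) ^ m * N ^ m" by (rule power_mult_distrib)
  also have "\<dots> < N * N ^ m" using N by (intro mult_strict_right_mono) (auto simp: N_def)
  finally show False by simp
qed

text \<open>The coordinates of \<open>A\<close> may be numerous; only the number of generators of the functions on \<open>S\<close> counts.
  That is why the bound refers to a second space \<open>B\<close> whose coordinates generate these functions.\<close>
lemma irreducible_chain_length_le:
  assumes chain: "\<And>i. i \<le> r \<Longrightarrow> closedin (subtopology (zariski A) T) (Z i) \<and>
      irreducible_in (subtopology (zariski A) T) (Z i)"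
    and strict: "\<And>i. i < r \<Longrightarrow> Z i \<subset> Z (Suc i)"
    and top: "Z r \<subseteq> S"
    and fin: "finite (coords B)"
    and gen: "\<And>g. g \<in> coords A \<Longrightarrow> \<exists>h\<in>poly_funs B. \<forall>x\<in>S. g x = h x"
  shows "r \<le> card (coords B)"
proof -
  have irr: "irreducible_in (zariski A) (Z i)" and ZT: "Z i \<subseteq> T" if "i \<le> r" for i
    using chain[OF that] by (auto simp: irreducible_in_subtopology)
  have "\<exists>p\<in>poly_funs A. (\<forall>x\<in>Z i. p x = 0) \<and> (\<exists>x\<in>Z (Suc i). p x \<noteq> 0)" if i: "i < r" for i
  proof -
    obtain x where x: "x \<in> Z (Suc i)" "x \<notin> Z i" using strict[OF i] by auto
    obtain C where C: "closedin (zariski A) C" "Z i = C \<inter> T"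
      using chain[of i] i by (auto simp: closedin_subtopology)
    have x': "x \<in> points A" "x \<notin> C"
      using x C(2) ZT[of "Suc i"] irr[of "Suc i"] i by (auto simp: irreducible_in_def)
    obtain p where "p \<in> poly_funs A" "p x \<noteq> 0" "\<forall>y\<in>C. p y = 0"
      using closedin_zariski_separates[OF C(1) x'] .
    then show ?thesis using C(2) x(1) by auto
  qed
  then obtain p where p: "\<And>i. i < r \<Longrightarrow> p i \<in> poly_funs A"
    "\<And>i x. i < r \<Longrightarrow> x \<in> Z i \<Longrightarrow> p i x = 0" "\<And>i. i < r \<Longrightarrow> \<exists>x\<in>Z (Suc i). p i x \<noteq> 0"
    by metis
  have "\<exists>h\<in>poly_funs B. \<forall>x\<in>S. p i x = h x" if "i < r" for i
    using poly_funs_pullback[OF p(1)[OF that], of B S "\<lambda>x. x"] gen by auto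
  then obtain h where h: "\<And>i. i < r \<Longrightarrow> h i \<in> poly_funs B"
    "\<And>i x. i < r \<Longrightarrow> x \<in> S \<Longrightarrow> p i x = h i x"
    by metis
  have "\<exists>D. h i \<in> polys_upto (coords B) D" if "i < r" for i
    using poly_funs_in_polys_upto[OF fin h(1)[OF that]] .
  then obtain d where d: "\<And>i. i < r \<Longrightarrow> h i \<in> polys_upto (coords B) (d i)" by metis
  define D where "D = (\<Sum>i<r. d i)"
  have hD: "h i \<in> polys_upto (coords B) D" if "i < r" for i
    using polys_upto_mono[of "d i" D "coords B"] d[OF that] that
    by (auto simp: D_def intro: member_le_sum)
  \<comment> \<open>The \<open>N ^ r\<close> monomials in the \<open>h i\<close> with exponents below \<open>N\<close> are independent and expand into
    monomials in the coordinates of \<open>B\<close> with exponents at most \<open>r * N * D\<close>.\<close>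
  show ?thesis
  proof (rule exponent_le_if_power_bound)
    fix N :: nat
    let ?E = "PiE {..<r} (\<lambda>_. {..<N})"
    define m where "m a x = (\<Prod>i<r. h i x ^ a i)" for a x
    have finE: "finite ?E" by (simp add: finite_PiE)
    have indep: "\<forall>a\<in>?E. c a = 0" if "\<And>x. (\<Sum>a\<in>?E. c a * m a x) = 0" for c
    proof (rule chain_monomials_independent[where A = A and Z = Z and p = p])
      show "(\<Sum>a\<in>?E. c a * (\<Prod>i<r. p i x ^ a i)) = 0" if "x \<in> Z r" for x
      proof -
        have "(\<Prod>i<r. p i x ^ a i) = m a x" for a
          unfolding m_def by (intro prod.cong) (use h(2) \<open>x \<in> Z r\<close> top in auto)
        then show ?thesis using \<open>\<And>x. (\<Sum>a\<in>?E. c a * m a x) = 0\<close> by simp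
      qed
    qed (assumption | rule irr psubset_imp_subset[OF strict] p)+
    have delta: "(\<Sum>e\<in>?E. (if e = a then 1 else 0) * m e x) = m a x" if "a \<in> ?E" for a x
    proof -
      have "(\<Sum>e\<in>?E. (if e = a then 1 else 0) * m e x) = (\<Sum>e\<in>?E. if e = a then m e x else 0)"
        by (intro sum.cong) auto
      then show ?thesis using that finE by simp
    qed
    have inj: "inj_on m ?E"
    proof
      fix a b assume ab: "a \<in> ?E" "b \<in> ?E" "m a = m b"
      show "a = b"
      proof (rule ccontr)
        assume "a \<noteq> b"
        have "(\<Sum>e\<in>?E. ((if e = a then 1 else 0) - (if e = b then 1 else 0)) * m e x) = m a x - m b x" for x
          by (simp only: left_diff_distrib sum_subtractf delta ab(1,2))
        then have "\<forall>e\<in>?E. (if e = a then 1 else 0) - (if e = b then 1 else 0) = (0 :: 'b)"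
          using ab(3) by (intro indep) simp
        then show False using ab(1) \<open>a \<noteq> b\<close> by auto
      qed
    qed
    have "function_space.independent (m ` ?E)"
    proof (rule function_space.independent_if_scalars_zero)
      show "finite (m ` ?E)" using finE by simp
      fix c f assume c: "(\<Sum>f\<in>m ` ?E. fun_scale (*) (c f) f) = 0" and f: "f \<in> m ` ?E"
      have "(\<Sum>a\<in>?E. c (m a) * m a x) = (\<Sum>f\<in>m ` ?E. fun_scale (*) (c f) f) x" for x
        by (simp add: sum.reindex[OF inj] sum_pointwise fun_scale_def)
      then have "\<forall>a\<in>?E. c (m a) = 0" using c by (intro indep) (simp add: zero_fun_def)
      then show "c f = 0" using f by auto
    qed
    moreover have "m ` ?E \<subseteq> function_space.span (monomials_upto (coords B) (r * (N * D)))"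
    proof
      fix f assume "f \<in> m ` ?E"
      then obtain a where a: "a \<in> ?E" "f = m a" by auto
      have "(\<lambda>x. h i x ^ a i) \<in> polys_upto (coords B) (N * D)" if i: "i < r" for i
      proof -
        have "a i * D \<le> N * D" using a(1) i by (intro mult_right_mono) (auto simp: PiE_iff less_imp_le)
        then show ?thesis using polys_upto_power[OF hD[OF i], of "a i"] polys_upto_mono by blast
      qed
      then have "(\<lambda>x. \<Prod>i<r. h i x ^ a i) \<in> polys_upto (coords B) (r * (N * D))"
        by (rule polys_upto_prod)
      then show "f \<in> function_space.span (monomials_upto (coords B) (r * (N * D)))"
        by (simp add: a(2) m_def[abs_def] polys_upto_def)
    qed
    ultimately have "card (m ` ?E) \<le> card (monomials_upto (coords B) (r * (N * D)))"
      using function_space.independent_span_bound[OF finite_monomials_upto[OF fin]] by blast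
    also have "\<dots> \<le> (r * (N * D) + 1) ^ card (coords B)" by (rule card_monomials_upto_le[OF fin])
    finally show "N ^ r \<le> (r * D * N + 1) ^ card (coords B)"
      by (simp add: card_image[OF inj] card_PiE mult.assoc mult.commute[of N D])
  qed
qed

text \<open>The functions on the image are generated by the coordinates of \<open>A\<close>, transported by the left inverse.\<close>
lemma irreducible_chain_in_embedding_length_le:
  assumes emb: "polynomial_embedding A B \<phi> \<psi>" and fin: "finite (coords A)"
    and chain: "\<And>i. i \<le> r \<Longrightarrow> closedin (subtopology (zariski B) T) (Z i) \<and>
      irreducible_in (subtopology (zariski B) T) (Z i)"
    and strict: "\<And>i. i < r \<Longrightarrow> Z i \<subset> Z (Suc i)"
    and top: "Z r \<subseteq> \<phi> ` points A"
  shows "r \<le> card (coords A)"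
proof -
  let ?C = "(UNIV, (\<lambda>g y. g (\<psi> y)) ` coords A)"
  have "r \<le> card (coords ?C)"
  proof (rule irreducible_chain_length_le[OF chain strict top])
    show "finite (coords ?C)" using fin by simp
    fix g assume g: "g \<in> coords B"
    have maps: "polynomial_map A B \<phi>" and inv: "\<forall>x\<in>points A. \<psi> (\<phi> x) = x"
      using emb by (simp_all add: polynomial_embedding_def)
    obtain h where h: "h \<in> poly_funs A" "\<And>x. x \<in> points A \<Longrightarrow> g (\<phi> x) = h x"
      by (rule polynomial_map_pullback[OF maps poly_funs.coord[OF g]]) (rule that; simp)
    have "\<exists>k\<in>poly_funs ?C. \<forall>y\<in>UNIV. f (\<psi> y) = k y" if "f \<in> coords A" for f
      by (intro bexI[of _ "\<lambda>y. f (\<psi> y)"] poly_funs.coord) (use that in auto)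
    then have "\<exists>k\<in>poly_funs ?C. \<forall>y\<in>UNIV. h (\<psi> y) = k y" by (rule poly_funs_pullback[OF h(1)])
    then obtain k where k: "k \<in> poly_funs ?C" "\<forall>y\<in>UNIV. h (\<psi> y) = k y" ..
    have "\<forall>y\<in>\<phi> ` points A. g y = k y"
    proof
      fix y assume "y \<in> \<phi> ` points A"
      then obtain x where "x \<in> points A" "y = \<phi> x" by auto
      then show "g y = k y" using h(2)[of x] inv k(2)[rule_format, of y] by simp
    qed
    then show "\<exists>h\<in>poly_funs ?C. \<forall>y\<in>\<phi> ` points A. g y = h y" by (intro bexI[of _ k] k(1))
  qed simp_all
  also have "\<dots> \<le> card (coords A)" using card_image_le[OF fin] by simp
  finally show ?thesis .
qed

section \<open>Coordinates and the multiplication table\<close>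

lemma lin_add: "f \<in> End scale \<Longrightarrow> f (x + y) = f x + f y"
  by (simp add: End_def Vector_Spaces.linear_iff)

lemma lin_scale: "f \<in> End scale \<Longrightarrow> f (scale r x) = scale r (f x)"
  by (simp add: End_def Vector_Spaces.linear_iff)

lemma lin_zero: "f \<in> End scale \<Longrightarrow> f 0 = 0"
  using lin_add[of f scale 0 0] by simp

lemma lin_sum: "f \<in> End scale \<Longrightarrow> f (\<Sum>i\<in>I. g i) = (\<Sum>i\<in>I. f (g i))"
  by (induction I rule: infinite_finite_induct) (simp_all add: lin_zero lin_add)

context evolution_algebra
begin

abbreviation co where "co \<equiv> coord scale n e"

lemma co_add: "co i (x + y) = co i x + co i y"
  using representation_add[OF independent_basis] span_basis by (simp add: coord_def)

lemma co_scale: "co i (scale r x) = r * co i x"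
  using representation_scale[OF independent_basis] span_basis by (simp add: coord_def)

lemma co_zero [simp]: "co i 0 = 0"
  using representation_zero[of "e ` {1..n}"] by (simp add: coord_def)

lemma co_sum: "co i (\<Sum>j\<in>I. f j) = (\<Sum>j\<in>I. co i (f j))"
  by (induction I rule: infinite_finite_induct) (simp_all add: co_add)

lemma co_basis: "i \<in> {1..n} \<Longrightarrow> j \<in> {1..n} \<Longrightarrow> co i (e j) = (if i = j then 1 else 0)"
  using representation_basis[OF independent_basis, of "e j"] inj_on_eq_iff[OF inj_basis, of i j]
  by (auto simp: coord_def)

lemma basis_expansion: "x = (\<Sum>i = 1..n. scale (co i x) (e i))"
proof -
  have "(\<Sum>b\<in>e ` {1..n}. scale (representation (e ` {1..n}) x b) b) = x"
    using span_basis by (intro sum_representation_eq independent_basis) auto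
  then show ?thesis by (simp only: sum.reindex[OF inj_basis] coord_def o_def)
qed

lemma co_eqI: "(\<And>i. i \<in> {1..n} \<Longrightarrow> co i x = co i y) \<Longrightarrow> x = y"
  by (subst (1 2) basis_expansion) (rule sum.cong; simp)

lemma End_expansion: "f \<in> End scale \<Longrightarrow> f x = (\<Sum>i = 1..n. scale (co i x) (f (e i)))"
  by (subst basis_expansion[of x]) (simp add: lin_sum lin_scale)

lemma End_eqI:
  assumes "f \<in> End scale" "g \<in> End scale"
    and "\<And>i j. i \<in> {1..n} \<Longrightarrow> j \<in> {1..n} \<Longrightarrow> co i (f (e j)) = co i (g (e j))"
  shows "f = g"
proof
  fix x
  have "f (e j) = g (e j)" if "j \<in> {1..n}" for j by (rule co_eqI) (rule assms(3)[OF _ that])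
  then show "f x = g x" by (simp add: End_expansion[OF assms(1), of x] End_expansion[OF assms(2), of x])
qed

lemma mul_End: "mul x \<in> End scale" "(\<lambda>x. mul x y) \<in> End scale"
  using mul_linear_left mul_linear_right by (simp_all add: End_def)

lemma mul_basis_right: "i \<in> {1..n} \<Longrightarrow> mul x (e i) = scale (co i x) (mul (e i) (e i))"
proof -
  assume i: "i \<in> {1..n}"
  have "mul x (e i) = (\<Sum>j = 1..n. scale (co j x) (mul (e j) (e i)))"
    using End_expansion[OF mul_End(2)] .
  also have "\<dots> = (\<Sum>j = 1..n. if j = i then scale (co i x) (mul (e i) (e i)) else 0)"
    using mul_distinct i by (intro sum.cong) auto
  finally show ?thesis using i by simp
qed

lemma mul_expansion: "mul x y = (\<Sum>i = 1..n. scale (co i x * co i y) (mul (e i) (e i)))"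
  unfolding End_expansion[OF mul_End(1), of x y]
proof (rule sum.cong)
  fix i assume "i \<in> {1..n}"
  from mul_basis_right[OF this, of x]
  show "scale (co i y) (mul x (e i)) = scale (co i x * co i y) (mul (e i) (e i))"
    by (simp only: scale_scale mult.commute)
qed simp

lemma mul_basis_left: "i \<in> {1..n} \<Longrightarrow> mul (e i) y = scale (co i y) (mul (e i) (e i))"
proof -
  assume i: "i \<in> {1..n}"
  have "mul (e i) y = (\<Sum>j = 1..n. if j = i then scale (co i y) (mul (e i) (e i)) else 0)"
    unfolding mul_expansion[of "e i" y] by (intro sum.cong) (use i in \<open>simp_all add: co_basis\<close>)
  then show ?thesis using i by simp
qed

end

context max_nilindex_normal_form
begin

lemma co_square:
  assumes i: "i \<in> {1..<n}" and j: "j \<in> {1..n}"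
  shows "co j (mul (e i) (e i)) = (if j \<le> i then 0 else if j = i + 1 then 1 else if j < n then a i j else 0)"
proof -
  consider "i \<le> n - 3" | "i = n - 2" | "i = n - 1" using i by fastforce
  then show ?thesis
  proof cases
    case 1
    have "co j (mul (e i) (e i)) = co j (e (i + 1)) + (\<Sum>l = i + 2..n - 1. a i l * co j (e l))"
      using square[of i] i 1 by (simp add: co_add co_sum co_scale)
    also have "(\<Sum>l = i + 2..n - 1. a i l * co j (e l)) = (\<Sum>l = i + 2..n - 1. if l = j then a i j else 0)"
      using j by (intro sum.cong) (auto simp: co_basis)
    also have "co j (e (i + 1)) = (if j = i + 1 then 1 else 0)" using i j by (simp add: co_basis)
    finally show ?thesis using i j n_ge_3 by auto
  next
    case 2
    then have "n - 1 = i + 1" using n_ge_3 by simp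
    then have "mul (e i) (e i) = e (i + 1)" using square_n2 2 by simp
    then show ?thesis using 2 i j n_ge_3 by (auto simp: co_basis)
  next
    case 3
    then have "mul (e i) (e i) = e (i + 1)" using square_n1 n_ge_3 by simp
    then show ?thesis using 3 i j n_ge_3 by (auto simp: co_basis)
  qed
qed

lemma mul_expansion_squares:
  "mul x y = (\<Sum>i = 1..<n. scale (co i x * co i y) (mul (e i) (e i)))"
proof -
  have "{1..n} = insert n {1..<n}" using n_ge_3 by auto
  then show ?thesis by (simp add: mul_expansion[of x y] square_n)
qed

text \<open>The square of \<open>e k\<close> starts with \<open>e (k + 1)\<close>, so the first nonzero coefficient of a combination of
  squares can be read off.\<close>
lemma co_square_combination:
  assumes m: "m \<in> {1..<n}" and s: "\<And>l. l \<in> {1..<m} \<Longrightarrow> s l = 0"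
  shows "co (m + 1) (\<Sum>k = 1..<n. scale (s k) (mul (e k) (e k))) = s m"
proof -
  have "co (m + 1) (\<Sum>k = 1..<n. scale (s k) (mul (e k) (e k))) = (\<Sum>k = 1..<n. if k = m then s m else 0)"
    unfolding co_sum co_scale
  proof (rule sum.cong)
    fix k assume "k \<in> {1..<n}"
    then show "s k * co (m + 1) (mul (e k) (e k)) = (if k = m then s m else 0)"
      using m s[of k] co_square[of k "m + 1"] by (cases "k < m") auto
  qed simp
  then show ?thesis using m by simp
qed

lemma square_combination_zero:
  assumes v: "\<And>j. j \<in> {1..m} \<Longrightarrow> co j (\<Sum>k = 1..<n. scale (s k) (mul (e k) (e k))) = 0" and "m \<le> n"
  shows "k \<in> {1..<m} \<Longrightarrow> s k = 0"
proof (induction k rule: less_induct)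
  case (less k)
  then have "s k = co (k + 1) (\<Sum>k = 1..<n. scale (s k) (mul (e k) (e k)))"
    using \<open>m \<le> n\<close> by (intro co_square_combination[symmetric]) auto
  then show ?case using v[of "k + 1"] less.prems by simp
qed

section \<open>Rota--Baxter operators\<close>

text \<open>Since \<open>e n\<close> annihilates the algebra, the coefficients \<open>c i\<close> do not enter the products, and the identity
  reduces to one condition for each square.\<close>
lemma RB0I_diagonal:
  assumes R: "R \<in> End scale"
    and diag: "\<And>i. i \<in> {1..n} \<Longrightarrow> R (e i) = scale (l i) (e i) + scale (c i) (e n)"
    and eigen: "\<And>i. i \<in> {1..<n} \<Longrightarrow>
      scale (l i ^ 2) (mul (e i) (e i)) = scale (2 * l i) (R (mul (e i) (e i)))"
  shows "R \<in> RB0 scale mul"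
proof -
  have co_R: "co i (R x) = l i * co i x" if i: "i \<in> {1..<n}" for i x
  proof -
    have "co i (R x) = (\<Sum>j = 1..n. if j = i then l i * co i x else 0)"
      unfolding End_expansion[OF R, of x] co_sum co_scale
      by (intro sum.cong) (use i in \<open>auto simp: diag co_add co_scale co_basis\<close>)
    then show ?thesis using i by simp
  qed
  have "mul (R x) (R y) = R (mul (R x) y + mul x (R y))" for x y
  proof -
    have "mul (R x) y + mul x (R y) =
        (\<Sum>i = 1..<n. scale (co i x * co i y * (2 * l i)) (mul (e i) (e i)))"
      unfolding mul_expansion_squares[of "R x" y] mul_expansion_squares[of x "R y"] sum.distrib[symmetric]
        scale_left_distrib[symmetric]
      by (rule sum.cong) (simp_all add: co_R mult.assoc mult.left_commute)
    then have "R (mul (R x) y + mul x (R y)) =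
        (\<Sum>i = 1..<n. scale (co i x * co i y) (scale (2 * l i) (R (mul (e i) (e i)))))"
      by (simp only: lin_sum[OF R] lin_scale[OF R] scale_scale)
    also have "\<dots> = (\<Sum>i = 1..<n. scale (co i x * co i y * l i ^ 2) (mul (e i) (e i)))"
      using eigen[symmetric] by (intro sum.cong) simp_all
    also have "\<dots> = mul (R x) (R y)"
      unfolding mul_expansion_squares[of "R x" "R y"]
      by (rule sum.cong) (simp_all add: co_R power2_eq_square mult.assoc mult.left_commute)
    finally show ?thesis by simp
  qed
  then show ?thesis using R by (simp add: RB0_def)
qed

context
  fixes R assumes RB: "R \<in> RB0 scale mul"
begin

lemma RB_End: "R \<in> End scale"
  using RB by (simp add: RB0_def)

lemma RB_basis_pair:
  assumes "i \<in> {1..n}" "j \<in> {1..n}"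
  shows "(\<Sum>k = 1..<n. scale (co k (R (e i)) * co k (R (e j))) (mul (e k) (e k))) =
    scale (co j (R (e i))) (R (mul (e j) (e j))) + scale (co i (R (e j))) (R (mul (e i) (e i)))"
proof -
  have "mul (R (e i)) (R (e j)) = R (mul (R (e i)) (e j) + mul (e i) (R (e j)))"
    using RB by (simp add: RB0_def)
  then show ?thesis
    by (simp only: mul_expansion_squares[of "R (e i)" "R (e j)"] mul_basis_left[OF assms(1), of "R (e j)"]
        mul_basis_right[OF assms(2), of "R (e i)"] lin_add[OF RB_End] lin_scale[OF RB_End])
qed

lemma RB_basis_diag:
  assumes "i \<in> {1..n}"
  shows "(\<Sum>k = 1..<n. scale (co k (R (e i)) ^ 2) (mul (e k) (e k))) =
    scale (2 * co i (R (e i))) (R (mul (e i) (e i)))"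
  using RB_basis_pair[OF assms assms] by (simp add: power2_eq_square scale_left_distrib[symmetric])

text \<open>In these cases the right side of the diagonal equation is zero, so a combination of the independent squares
  with coefficients \<open>co k (R (e i)) ^ 2\<close> vanishes.\<close>
lemma RB_off_diagonal_zero_if_eigenvalue_zero:
  assumes "i \<in> {1..n}" "co i (R (e i)) = 0 \<or> i = n" "k \<in> {1..<n}"
  shows "co k (R (e i)) = 0"
proof -
  have "co k (R (e i)) ^ 2 = 0"
  proof (rule square_combination_zero[of n "\<lambda>k. co k (R (e i)) ^ 2"])
    show "co j (\<Sum>k = 1..<n. scale (co k (R (e i)) ^ 2) (mul (e k) (e k))) = 0" for j
      unfolding RB_basis_diag[OF assms(1)] using assms(2) by (auto simp: square_n lin_zero[OF RB_End])
  qed (use assms in auto)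
  then show ?thesis by simp
qed

text \<open>As long as \<open>R\<close> is diagonal modulo \<open>e n\<close> on the basis vectors after \<open>e i\<close>, it multiplies the coordinates
  of the square of \<open>e i\<close> by its eigenvalues. The \<open>e n\<close>-coordinate also collects all the \<open>c j\<close>, so it is admitted
  only if \<open>e n\<close> is the leading term of the square.\<close>
lemma co_R_square:
  assumes diag: "\<And>j k. j \<in> {i + 1..n} \<Longrightarrow> k \<in> {1..<n} \<Longrightarrow> k \<noteq> j \<Longrightarrow> co k (R (e j)) = 0"
    and i: "i \<in> {1..<n}" and k: "k \<in> {1..<n} \<or> k = i + 1"
  shows "co k (R (mul (e i) (e i))) = co k (mul (e i) (e i)) * co k (R (e k))"
proof -
  have "co k (R (mul (e i) (e i))) = (\<Sum>j = 1..n. co j (mul (e i) (e i)) * co k (R (e j)))"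
    using End_expansion[OF RB_End, of "mul (e i) (e i)"] by (simp add: co_sum co_scale)
  also have "\<dots> = (\<Sum>j = 1..n. if j = k then co k (mul (e i) (e i)) * co k (R (e k)) else 0)"
  proof (rule sum.cong)
    fix j assume j: "j \<in> {1..n}"
    show "co j (mul (e i) (e i)) * co k (R (e j)) =
      (if j = k then co k (mul (e i) (e i)) * co k (R (e k)) else 0)"
      using diag[of j k] k co_square[OF i j] i j by (cases "j \<le> i") auto
  qed simp
  also have "\<dots> = co k (mul (e i) (e i)) * co k (R (e k))" using k i by auto
  finally show ?thesis .
qed

text \<open>Descending induction on \<open>i\<close>. If the eigenvalue at \<open>i\<close> is not zero, the diagonal equation at the
  coordinates up to \<open>i + 1\<close> removes the entries before \<open>i\<close> and shows that the eigenvalue is twice the next one; the latter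
  is then nonzero, so by induction the whole ladder of powers of two follows. An entry at \<open>j > i\<close> is removed by
  the equation for the pair \<open>(i, j)\<close>: it is multiplied there by the difference of consecutive eigenvalues,
  which is nonzero on the ladder.\<close>
lemma RB_structure:
  assumes "i \<in> {1..n}"
  shows "(\<forall>k\<in>{1..<n}. k \<noteq> i \<longrightarrow> co k (R (e i)) = 0) \<and>
    (i < n \<longrightarrow> co i (R (e i)) \<noteq> 0 \<longrightarrow> (\<forall>j\<in>{i..n}. co j (R (e j)) = 2 ^ (n - j) * co n (R (e n))))"
  using assms
proof (induction "n - i" arbitrary: i rule: less_induct)
  case less
  show ?case
  proof (cases "i = n \<or> co i (R (e i)) = 0")
    case True
    then have "\<forall>k\<in>{1..<n}. co k (R (e i)) = 0"
      by (intro ballI RB_off_diagonal_zero_if_eigenvalue_zero less.prems) blast+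
    then show ?thesis using True by blast
  next
    case False
    define l where "l j = co j (R (e j))" for j
    have i: "i \<in> {1..<n}" and li: "l i \<noteq> 0" using False less.prems by (auto simp: l_def)
    have diag: "co k (R (e j)) = 0" if "j \<in> {i + 1..n}" "k \<in> {1..<n}" "k \<noteq> j" for j k
      using less.hyps[of j] that i by auto
    have eq: "(\<Sum>k = 1..<n. scale (co k (R (e i)) ^ 2) (mul (e k) (e k))) =
        scale (2 * l i) (R (mul (e i) (e i)))"
      using RB_basis_diag i by (simp add: l_def)
    have below: "co k (R (e i)) = 0" if k: "k \<in> {1..<i}" for k
    proof -
      have "co k (R (e i)) ^ 2 = 0"
      proof (rule square_combination_zero[of i "\<lambda>k. co k (R (e i)) ^ 2"])
        fix j assume "j \<in> {1..i}"
        then show "co j (\<Sum>k = 1..<n. scale (co k (R (e i)) ^ 2) (mul (e k) (e k))) = 0"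
          unfolding eq co_scale using i co_square[of i j]
          by (subst co_R_square[OF diag]) auto
      qed (use i k in auto)
      then show ?thesis by simp
    qed
    have "co (i + 1) (\<Sum>k = 1..<n. scale (co k (R (e i)) ^ 2) (mul (e k) (e k))) = l i ^ 2"
      using i below by (subst co_square_combination) (auto simp: l_def)
    moreover have "co (i + 1) (R (mul (e i) (e i))) = l (i + 1)"
      using i by (subst co_R_square[OF diag]) (auto simp: co_square l_def)
    ultimately have "l i ^ 2 = 2 * l i * l (i + 1)" unfolding eq co_scale by simp
    then have half: "l i = 2 * l (i + 1)" using li by (simp add: power2_eq_square)
    have ladder: "l j = 2 ^ (n - j) * l n" if j: "j \<in> {i + 1..n}" for j
    proof (cases "i + 1 = n")
      case True
      then show ?thesis using j by simp
    next
      case False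
      have "n - (i + 1) < n - i" "i + 1 \<in> {1..n}" "i + 1 < n" using False i by auto
      moreover have "co (i + 1) (R (e (i + 1))) \<noteq> 0" using half li by (auto simp: l_def)
      ultimately show ?thesis using less.hyps[of "i + 1"] j unfolding l_def by blast
    qed
    have "n - i = Suc (n - (i + 1))" using i by auto
    then have li_eq: "l i = 2 ^ (n - i) * l n" using half ladder[of "i + 1"] i by simp
    have above: "co j (R (e i)) = 0" if j: "j \<in> {i + 1..<n}" for j
    proof -
      let ?s = "\<lambda>k. co k (R (e i)) * co k (R (e j))"
      have s0: "?s k = 0" if "k \<in> {1..<j}" for k using diag[of j k] that j by auto
      have "?s j = co (j + 1) (\<Sum>k = 1..<n. scale (?s k) (mul (e k) (e k)))"
        using j s0 by (subst co_square_combination) auto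
      also have "\<dots> = co j (R (e i)) * co (j + 1) (R (mul (e j) (e j)))"
        using RB_basis_pair[of i j] i j diag[of j i] by (simp add: co_scale)
      also have "co (j + 1) (R (mul (e j) (e j))) = l (j + 1)"
      proof -
        have "co k (R (e j')) = 0" if "j' \<in> {j + 1..n}" "k \<in> {1..<n}" "k \<noteq> j'" for j' k
          using diag[of j' k] that j by auto
        then show ?thesis using j by (subst co_R_square) (auto simp: co_square l_def)
      qed
      finally have "co j (R (e i)) * (l j - l (j + 1)) = 0" by (simp add: l_def right_diff_distrib)
      moreover have "n - j = Suc (n - (j + 1))" using j by auto
      then have "l j - l (j + 1) = 2 ^ (n - (j + 1)) * l n"
        using ladder[of j] ladder[of "j + 1"] j by simp
      moreover have "l n \<noteq> 0" using li_eq li by auto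
      ultimately show ?thesis by (metis mult_eq_0_iff power_eq_0_iff zero_neq_numeral)
    qed
    have "co k (R (e i)) = 0" if "k \<in> {1..<n}" "k \<noteq> i" for k
      using that below[of k] above[of k] by (cases "k < i") auto
    moreover have "l j = 2 ^ (n - j) * l n" if "j \<in> {i..n}" for j
      using that ladder[of j] li_eq by (cases "j = i") auto
    ultimately show ?thesis unfolding l_def by blast
  qed
qed

lemma RB_off_diagonal: "i \<in> {1..n} \<Longrightarrow> k \<in> {1..<n} \<Longrightarrow> k \<noteq> i \<Longrightarrow> co k (R (e i)) = 0"
  using RB_structure[of i] by blast

lemma RB_eigenvalues:
  assumes "i \<in> {1..<n}" "co i (R (e i)) \<noteq> 0" "j \<in> {i..n}"
  shows "co j (R (e j)) = 2 ^ (n - j) * co n (R (e n))"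
  using RB_structure[of i] assms by (meson atLeastLessThan_iff atLeastAtMost_iff less_imp_le)

text \<open>The coordinate \<open>j\<close> of the diagonal equation reads \<open>a i j * (\<lambda>\<^sub>i - 2 \<lambda>\<^sub>j) = 0\<close>, and equality
  \<open>\<lambda>\<^sub>i = 2 \<lambda>\<^sub>j\<close> holds on the ladder for \<open>j = i + 1\<close> only.\<close>
lemma RB_no_obstruction:
  assumes i: "i \<in> {1..<n}" and nz: "co i (R (e i)) \<noteq> 0" and j: "i + 1 < j" "j < n"
  shows "a i j = 0"
proof -
  define \<alpha> where "\<alpha> = co n (R (e n))"
  have l: "co i (R (e i)) = 2 ^ (n - i) * \<alpha>" "co j (R (e j)) = 2 ^ (n - j) * \<alpha>"
    unfolding \<alpha>_def by (rule RB_eigenvalues[OF i nz]; use i j in simp)+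
  have "co j (\<Sum>k = 1..<n. scale (co k (R (e i)) ^ 2) (mul (e k) (e k))) =
      (\<Sum>k = 1..<n. if k = i then co i (R (e i)) ^ 2 * a i j else 0)"
    unfolding co_sum co_scale
    by (intro sum.cong) (use i j in \<open>auto simp: RB_off_diagonal co_square\<close>)
  then have "co i (R (e i)) ^ 2 * a i j = 2 * co i (R (e i)) * co j (R (mul (e i) (e i)))"
    using i RB_basis_diag[of i] by (simp add: co_scale)
  also have "co j (R (mul (e i) (e i))) = a i j * co j (R (e j))"
    using i j by (subst co_R_square) (auto simp: RB_off_diagonal co_square)
  finally have "a i j * (co i (R (e i)) - 2 * co j (R (e j))) = 0"
    using nz by (simp add: power2_eq_square algebra_simps)
  moreover have "(2 :: 'k) ^ (n - i) \<noteq> 2 ^ (n - j + 1)"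
  proof
    assume "(2 :: 'k) ^ (n - i) = 2 ^ (n - j + 1)"
    then have "of_nat (2 ^ (n - i)) = (of_nat (2 ^ (n - j + 1)) :: 'k)" by simp
    then have "(2 :: nat) ^ (n - i) = 2 ^ (n - j + 1)" by (simp only: of_nat_eq_iff)
    then have "n - i = n - j + 1" by (simp only: power_inject_exp one_less_numeral_iff semiring_norm)
    then show False using i j by auto
  qed
  then have "co i (R (e i)) - 2 * co j (R (e j)) \<noteq> 0"
    using nz unfolding l by auto
  ultimately show ?thesis by simp
qed

end

end

section \<open>Local Rota--Baxter operators\<close>

lemma obstruction_index_props:
  shows obstruction_index_bound: "n \<ge> 3 \<Longrightarrow> obstruction_index n a + 1 \<le> n - 1"
    and no_obstruction_above: "obstruction_index n a < i \<Longrightarrow> i + 1 < j \<Longrightarrow> j < n \<Longrightarrow> a i j = 0"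
    and obstruction_index_less: "0 < k \<Longrightarrow>
      (\<And>i j. k \<le> i \<Longrightarrow> i + 1 < j \<Longrightarrow> j < n \<Longrightarrow> a i j = 0) \<Longrightarrow> obstruction_index n a < k"
proof -
  let ?I = "{i. \<exists>j. (i, j) \<in> obstruction_set n a}"
  have fin: "finite ?I" by (rule finite_subset[of _ "{..n}"]) (auto simp: obstruction_set_def)
  have Max_in: "Max ?I \<in> ?I" if "obstruction_set n a \<noteq> {}"
    using that by (intro Max_in fin) auto
  show "obstruction_index n a + 1 \<le> n - 1" if n: "n \<ge> 3"
  proof (cases "obstruction_set n a = {}")
    case False
    from Max_in[OF this] obtain j where "(Max ?I, j) \<in> obstruction_set n a" by auto
    then have "Max ?I + 1 \<le> n - 1" by (auto simp: obstruction_set_def)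
    then show ?thesis using False by (simp add: obstruction_index_def)
  qed (use n in \<open>simp add: obstruction_index_def\<close>)
  show "a i j = 0" if *: "obstruction_index n a < i" "i + 1 < j" "j < n"
  proof (rule ccontr)
    assume "a i j \<noteq> 0"
    then have ij: "(i, j) \<in> obstruction_set n a" using * by (simp add: obstruction_set_def)
    then have "i \<le> Max ?I" by (intro Max_ge fin) auto
    moreover have "obstruction_index n a = Max ?I" using ij by (auto simp: obstruction_index_def)
    ultimately show False using *(1) by simp
  qed
  show "obstruction_index n a < k" if k: "0 < k"
    and zero: "\<And>i j. k \<le> i \<Longrightarrow> i + 1 < j \<Longrightarrow> j < n \<Longrightarrow> a i j = 0"
  proof (cases "obstruction_set n a = {}")
    case False
    from Max_in[OF this] obtain j where "(Max ?I, j) \<in> obstruction_set n a" by auto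
    then have "\<not> k \<le> Max ?I" using zero[of "Max ?I" j] by (auto simp: obstruction_set_def)
    then show ?thesis using False by (simp add: obstruction_index_def)
  qed (use k in \<open>simp add: obstruction_index_def\<close>)
qed

context evolution_algebra
begin

abbreviation T where "T \<equiv> Tk scale n e"

lemma T_End: "T k p \<in> End scale"
  by (cases p) (simp add: Tk_def linear_lin_ext)

lemma co_T:
  assumes i: "i \<in> {1..n}"
  shows "co i (T k (c, \<alpha>) x) = (if k \<le> i \<and> i < n then 2 ^ (n - i) * \<alpha> * co i x else 0) +
    (if i = n then \<Sum>j = 1..n. c j * co j x else 0)"
proof -
  let ?s = "\<lambda>j. if k \<le> j \<and> j < n then 2 ^ (n - j) * \<alpha> else 0"
  have "co i (T k (c, \<alpha>) x) = (\<Sum>j = 1..n. co j x * co i (scale (?s j) (e j) + scale (c j) (e n)))"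
    unfolding Tk_def prod.case lin_ext_def co_sum co_scale by (rule sum.cong) auto
  also have "\<dots> = (\<Sum>j = 1..n. (if j = i then ?s i * co i x else 0) + (if i = n then c j * co j x else 0))"
    by (rule sum.cong) (use i in \<open>auto simp: co_add co_scale co_basis algebra_simps\<close>)
  also have "\<dots> = ?s i * co i x + (if i = n then \<Sum>j = 1..n. c j * co j x else 0)"
    using i by (simp add: sum.distrib)
  finally show ?thesis by simp
qed

lemma co_T_basis:
  assumes "i \<in> {1..n}" "j \<in> {1..n}"
  shows "co i (T k (c, \<alpha>) (e j)) = (if k \<le> j \<and> j < n \<and> i = j then 2 ^ (n - j) * \<alpha> else 0) +
    (if i = n then c j else 0)"
proof -
  have "(\<Sum>l = 1..n. c l * co l (e j)) = (\<Sum>l = 1..n. if l = j then c j else 0)"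
    by (rule sum.cong) (use assms in \<open>auto simp: co_basis\<close>)
  then have "(\<Sum>l = 1..n. c l * co l (e j)) = c j" using assms by simp
  then show ?thesis using assms by (auto simp: co_T co_basis)
qed

text \<open>This makes \<open>V0\<close> the face \<open>\<alpha> = 0\<close> of every parametrisation \<open>T k\<close>.\<close>
lemma T0_eq_T: "T0 scale n e c = T k (c, 0)"
  by (simp add: T0_def Tk_def) (auto simp: lin_ext_def intro!: ext sum.cong)

lemma T_basis:
  assumes "i \<in> {1..n}"
  shows "T k (c, \<alpha>) (e i) = scale (if k \<le> i \<and> i < n then 2 ^ (n - i) * \<alpha> else 0) (e i) + scale (c i) (e n)"
  by (rule co_eqI) (use assms in \<open>auto simp: co_T_basis co_add co_scale co_basis\<close>)

text \<open>Recovers \<open>(c, \<alpha>)\<close> from the matrix of \<open>T k (c, \<alpha>)\<close> by the same formula for all \<open>k\<close>: each \<open>k\<close> below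
  \<open>n\<close> has the eigenvalue \<open>2 * \<alpha>\<close> at \<open>e (n - 1)\<close>.\<close>
definition params :: "('v \<Rightarrow> 'v) \<Rightarrow> (nat \<Rightarrow> 'k) \<times> 'k" where
  "params f = (\<lambda>j. if j \<in> {1..n} then co n (f (e j)) else 0, co (n - 1) (f (e (n - 1))) / 2)"

lemma params_T:
  assumes "c \<in> Kn n" "k \<in> {1..n - 1}"
  shows "params (T k (c, \<alpha>)) = (c, \<alpha>)"
proof -
  have "n - 1 \<in> {1..n}" "k \<le> n - 1" "n - 1 < n" "n - (n - 1) = 1" using assms(2) by auto
  then have "co (n - 1) (T k (c, \<alpha>) (e (n - 1))) = 2 * \<alpha>"
    by (simp only: co_T_basis) simp
  moreover have "co n (T k (c, \<alpha>) (e j)) = c j" if "j \<in> {1..n}" for j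
    using that by (subst co_T_basis) auto
  moreover have "c j = 0" if "j \<notin> {1..n}" for j using assms(1) that by (simp add: Kn_def)
  ultimately show ?thesis by (auto simp: params_def)
qed

end

context max_nilindex_normal_form
begin

abbreviation i0 where "i0 \<equiv> obstruction_index n a"

lemma T0_in_RB0: "T k (c, 0) \<in> RB0 scale mul"
  by (rule RB0I_diagonal[where l = "\<lambda>_. 0" and c = c]) (auto simp: T_End T_basis)

lemma square_above_i0:
  assumes "i0 < i" "i \<in> {1..<n}"
  shows "mul (e i) (e i) = e (i + 1)"
proof (rule co_eqI)
  fix j assume j: "j \<in> {1..n}"
  show "co j (mul (e i) (e i)) = co j (e (i + 1))"
    using assms j no_obstruction_above[OF assms(1), of j] by (auto simp: co_square co_basis)
qed

text \<open>Above the obstruction index squaring is the shift \<open>e i \<mapsto> e (i + 1)\<close>. The conditions on \<open>c\<close> make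
  \<open>e (i + 1)\<close> an eigenvector for \<open>k \<le> i\<close>, including \<open>e n\<close> with eigenvalue \<open>\<alpha>\<close>.\<close>
lemma T_in_RB0:
  assumes k: "k \<in> {i0 + 1..n - 1}" and c: "c n = \<alpha>" "\<And>i. i \<in> {k<..<n} \<Longrightarrow> c i = 0"
  shows "T k (c, \<alpha>) \<in> RB0 scale mul"
proof -
  let ?l = "\<lambda>i. if k \<le> i \<and> i < n then 2 ^ (n - i) * \<alpha> else 0"
  show ?thesis
  proof (rule RB0I_diagonal[OF T_End])
    fix i assume i: "i \<in> {1..<n}"
    show "scale (?l i ^ 2) (mul (e i) (e i)) = scale (2 * ?l i) (T k (c, \<alpha>) (mul (e i) (e i)))"
    proof (cases "k \<le> i")
      case True
      have "T k (c, \<alpha>) (e (i + 1)) = scale (2 ^ (n - (i + 1)) * \<alpha>) (e (i + 1))"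
        using True i c by (cases "i + 1 = n") (auto simp: T_basis)
      moreover have "mul (e i) (e i) = e (i + 1)" using True i k by (intro square_above_i0) auto
      moreover have "n - i = Suc (n - (i + 1))" using i by auto
      ultimately show ?thesis using True i by (simp add: power2_eq_square algebra_simps)
    qed simp
  qed (rule T_basis)
qed

text \<open>Given \<open>x\<close> with first nonzero coordinate \<open>m < n\<close>, the operator may be replaced by a Rota--Baxter operator
  with the same eigenvalues from \<open>max k m\<close> on: only one scalar, the \<open>e n\<close>-component of the value at \<open>x\<close>, remains to
  be matched. If \<open>x\<close> is a multiple of \<open>e n\<close>, the operator with \<open>\<alpha> = 0\<close> does.\<close>
lemma T_in_LRB0:
  assumes k: "k \<in> {i0 + 1..n - 1}"
  shows "T k (c, \<alpha>) \<in> LRB0 scale mul"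
proof -
  have "\<exists>R\<in>RB0 scale mul. T k (c, \<alpha>) x = R x" for x
  proof (cases "\<forall>i\<in>{1..<n}. co i x = 0")
    case True
    then have "T k (c, \<alpha>) x = T k (c, 0) x"
      by (intro co_eqI) (auto simp: co_T)
    then show ?thesis using T0_in_RB0 by blast
  next
    case False
    let ?P = "\<lambda>i. i \<in> {1..<n} \<and> co i x \<noteq> 0"
    define m where "m = (LEAST i. ?P i)"
    have m: "m \<in> {1..<n}" "co m x \<noteq> 0" and below: "\<And>i. i \<in> {1..<m} \<Longrightarrow> co i x = 0"
      using False LeastI_ex[of ?P] not_less_Least[of _ ?P] unfolding m_def[symmetric] by fastforce+
    define d where "d i = (if i = n then \<alpha> else if i = m then
        ((\<Sum>j = 1..n. c j * co j x) - \<alpha> * co n x) / co m x else 0)" for i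
    define K where "K = max k m"
    \<comment> \<open>\<open>K \<ge> m\<close> leaves the \<open>m\<close>-th coefficient free, and \<open>d m\<close> is chosen to match the \<open>e n\<close>-components;
      \<open>d n = \<alpha>\<close> is what the Rota--Baxter identity requires. The coordinates of \<open>x\<close> below \<open>m\<close> are zero, so
      raising \<open>k\<close> to \<open>K\<close> does not affect the value at \<open>x\<close>.\<close>
    define I where "I = {1..<n} - {m}"
    have I: "{1..n} = insert n (insert m I)" "n \<notin> insert m I" "m \<notin> I" "finite I"
      using m by (auto simp: I_def)
    have "(\<Sum>j = 1..n. d j * co j x) = d n * co n x + (d m * co m x + (\<Sum>j\<in>I. d j * co j x))"
      unfolding I(1) using I(2-4) by simp
    also have "(\<Sum>j\<in>I. d j * co j x) = 0" by (rule sum.neutral) (auto simp: d_def I_def)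
    finally have d: "(\<Sum>j = 1..n. d j * co j x) = (\<Sum>j = 1..n. c j * co j x)"
      using m by (auto simp: d_def)
    have "T k (c, \<alpha>) x = T K (d, \<alpha>) x"
    proof (rule co_eqI)
      fix i assume i: "i \<in> {1..n}"
      have "co i x = 0" if "i < K" "\<not> i < k" using that below i by (auto simp: K_def)
      then show "co i (T k (c, \<alpha>) x) = co i (T K (d, \<alpha>) x)"
        using i d by (auto simp: co_T K_def)
    qed
    moreover have "T K (d, \<alpha>) \<in> RB0 scale mul"
      using k m by (intro T_in_RB0) (auto simp: K_def d_def)
    ultimately show ?thesis by blast
  qed
  then show ?thesis by (simp add: LRB0_def T_End)
qed

text \<open>The shape of the matrix is seen at the basis vectors. The relation between the eigenvalues is not
  visible there, because each basis vector may use another operator; it is read off at the sum of the basis,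
  where one operator accounts for all of them.\<close>
lemma LRB0_imp_T:
  assumes f: "f \<in> LRB0 scale mul"
  shows "(\<exists>c\<in>Kn n. f = T0 scale n e c) \<or>
    (\<exists>k\<in>{i0 + 1..n - 1}. \<exists>c\<in>Kn n. \<exists>\<alpha>. \<alpha> \<noteq> 0 \<and> f = T k (c, \<alpha>))"
proof -
  have f_End: "f \<in> End scale" using f by (simp add: LRB0_def)
  define c where "c j = (if j \<in> {1..n} then co n (f (e j)) else 0)" for j
  have c: "c \<in> Kn n" by (simp add: Kn_def c_def)
  define l where "l j = co j (f (e j))" for j
  have diag: "co i (f (e j)) = 0" if "i \<in> {1..<n}" "j \<in> {1..n}" "i \<noteq> j" for i j
  proof -
    obtain R where "R \<in> RB0 scale mul" "f (e j) = R (e j)" using f unfolding LRB0_def by blast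
    then show ?thesis using RB_off_diagonal that by simp
  qed
  \<comment> \<open>One vector at which all eigenvalues with index below \<open>n\<close> are visible.\<close>
  define x where "x = (\<Sum>j = 1..n. e j)"
  obtain R where R: "R \<in> RB0 scale mul" "f x = R x" using f unfolding LRB0_def by blast
  have sum_x: "co i (g x) = co i (g (e i))"
    if g: "g \<in> End scale" and "i \<in> {1..<n}" "\<And>j. j \<in> {1..n} \<Longrightarrow> i \<noteq> j \<Longrightarrow> co i (g (e j)) = 0" for g i
  proof -
    have "co i (g x) = (\<Sum>j = 1..n. if j = i then co i (g (e i)) else 0)"
      unfolding x_def lin_sum[OF g] co_sum by (rule sum.cong) (use that in auto)
    then show ?thesis using that by simp
  qed
  have l_eq: "l i = co i (R (e i))" if i: "i \<in> {1..<n}" for i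
    using sum_x[OF f_End i diag[OF i]] sum_x[OF RB_End[OF R(1)] i RB_off_diagonal[OF R(1) _ i]] R(2)
    by (simp add: l_def)
  have f_eq: "f = T k (c, \<alpha>)"
    if "\<And>i. i \<in> {1..<n} \<Longrightarrow> l i = (if k \<le> i then 2 ^ (n - i) * \<alpha> else 0)" for k \<alpha>
  proof (rule End_eqI[OF f_End T_End])
    fix i j assume ij: "i \<in> {1..n}" "j \<in> {1..n}"
    show "co i (f (e j)) = co i (T k (c, \<alpha>) (e j))"
    proof (cases "i = n")
      case True
      then show ?thesis using ij by (auto simp: co_T_basis c_def)
    next
      case False
      then show ?thesis
        using ij that[of i] diag[of i j] by (cases "i = j") (auto simp: co_T_basis l_def)
    qed
  qed
  show ?thesis
  proof (cases "\<forall>i\<in>{1..<n}. l i = 0")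
    case True
    \<comment> \<open>With \<open>k = n\<close> the prescribed eigenvalues below \<open>n\<close> are all zero.\<close>
    then have "f = T n (c, 0)" by (intro f_eq) auto
    then have "f = T0 scale n e c" by (simp only: T0_eq_T[of c n])
    then show ?thesis using c by blast
  next
    case False
    let ?P = "\<lambda>i. i \<in> {1..<n} \<and> l i \<noteq> 0"
    define k where "k = (LEAST i. ?P i)"
    define \<alpha> where "\<alpha> = co n (R (e n))"
    have k: "k \<in> {1..<n}" "l k \<noteq> 0" and below: "\<And>i. i \<in> {1..<k} \<Longrightarrow> l i = 0"
      using False LeastI_ex[of ?P] not_less_Least[of _ ?P] unfolding k_def[symmetric] by fastforce+
    have nz: "co k (R (e k)) \<noteq> 0" using l_eq k by simp
    have above: "l i = 2 ^ (n - i) * \<alpha>" if i: "i \<in> {k..<n}" for i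
      using l_eq[of i] RB_eigenvalues[OF R(1) k(1) nz, of i] i k(1) by (simp add: \<alpha>_def)
    then have \<alpha>: "\<alpha> \<noteq> 0" using k by auto
    have "f = T k (c, \<alpha>)"
    proof (rule f_eq)
      fix i assume "i \<in> {1..<n}"
      then show "l i = (if k \<le> i then 2 ^ (n - i) * \<alpha> else 0)"
        using below[of i] above[of i] by auto
    qed
    moreover have "i0 < k"
    proof (rule obstruction_index_less)
      fix i j assume ij: "k \<le> i" "i + 1 < j" "j < n"
      then have i: "i \<in> {1..<n}" using k by auto
      have "l i \<noteq> 0" using above[of i] \<alpha> ij by auto
      then have "co i (R (e i)) \<noteq> 0" using l_eq[OF i] by simp
      then show "a i j = 0" using RB_no_obstruction[OF R(1) i] ij by simp
    qed (use k in simp)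
    then have "k \<in> {i0 + 1..n - 1}" using k(1) by auto
    ultimately show ?thesis using c \<alpha> by blast
  qed
qed

lemma LRB0_eq:
  "LRB0 scale mul = V0 scale n e \<union> (\<Union>k\<in>{i0 + 1..n - 1}. Vk scale n e k)"
proof (intro equalityI subsetI)
  fix f assume "f \<in> LRB0 scale mul"
  from LRB0_imp_T[OF this] show "f \<in> V0 scale n e \<union> (\<Union>k\<in>{i0 + 1..n - 1}. Vk scale n e k)"
    by (auto simp: V0_def Vk_def)
next
  fix f assume "f \<in> V0 scale n e \<union> (\<Union>k\<in>{i0 + 1..n - 1}. Vk scale n e k)"
  then consider c where "f = T0 scale n e c" | k c \<alpha> where "k \<in> {i0 + 1..n - 1}" "f = T k (c, \<alpha>)"
    by (auto simp: V0_def Vk_def) blast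
  then show "f \<in> LRB0 scale mul"
  proof cases
    case 1
    have "n - 1 \<in> {i0 + 1..n - 1}" using obstruction_index_bound[OF n_ge_3] by simp
    then show ?thesis using T_in_LRB0[of "n - 1" c 0] by (simp add: 1 T0_eq_T[of c "n - 1"])
  qed (use T_in_LRB0 in simp)
qed

end

section \<open>Parameter spaces\<close>

lemma coords_Kn_space: "coords (Kn_space n) = (\<lambda>i c. c i) ` {1..n}"
  by (auto simp: Kn_space_def)

lemma coords_Kn_times_K_space:
  "coords (Kn_times_K_space n) = insert (\<lambda>p. snd p) ((\<lambda>i p. fst p i) ` {1..n})"
  by (auto simp: Kn_times_K_space_def case_prod_unfold)

lemma card_coords_Kn_space: "card (coords (Kn_space n)) \<le> n" "finite (coords (Kn_space n))"
  using card_image_le[of "{1..n}" "\<lambda>i c. c i"] by (simp_all add: coords_Kn_space)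

lemma card_coords_Kn_times_K_space:
  "card (coords (Kn_times_K_space n)) \<le> n + 1" "finite (coords (Kn_times_K_space n))"
  using card_image_le[of "{1..n}" "\<lambda>i p. fst p i"]
  by (auto simp: coords_Kn_times_K_space intro: order_trans[OF card_insert_le_m1])

lemma points_Kn_space [simp]: "points (Kn_space n) = Kn n"
  by (simp add: Kn_space_def)

lemma points_Kn_times_K_space [simp]: "points (Kn_times_K_space n) = Kn n \<times> UNIV"
  by (simp add: Kn_times_K_space_def)

lemma Kn_mono: "i \<le> n \<Longrightarrow> Kn i \<subseteq> Kn n"
  by (auto simp: Kn_def)

lemma zero_in_Kn [simp]: "(\<lambda>_. 0) \<in> Kn n"
  by (simp add: Kn_def)

lemma Kn_psubset: "i < n \<Longrightarrow> (Kn i :: (nat \<Rightarrow> 'k::field) set) \<subset> Kn (Suc i)"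
proof -
  have "(\<lambda>j. if j = Suc i then 1 else 0) \<in> (Kn (Suc i) :: (nat \<Rightarrow> 'k) set) - Kn i"
    by (auto simp: Kn_def)
  then show ?thesis using Kn_mono[of i "Suc i"] by auto
qed

lemma affine_line_in_Kn: "c \<in> Kn n \<Longrightarrow> d \<in> Kn n \<Longrightarrow> (\<lambda>i. c i + t * (d i - c i)) \<in> Kn n"
  by (simp add: Kn_def)

text \<open>The curves are straight lines here.\<close>
lemma irreducible_in_parameters:
  fixes S :: "((nat \<Rightarrow> 'k::field_char_0) \<times> 'k) set"
  assumes S: "S \<subseteq> Kn n \<times> UNIV" "S \<noteq> {}"
    and line: "\<And>c \<alpha> d \<beta>. (c, \<alpha>) \<in> S \<Longrightarrow> (d, \<beta>) \<in> S \<Longrightarrow>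
      finite {t. (\<lambda>i. c i + t * (d i - c i), \<alpha> + t * (\<beta> - \<alpha>)) \<notin> S}"
  shows "irreducible_in (zariski (Kn_times_K_space n)) S"
proof (rule irreducible_in_if_curve_connected)
  fix p q assume pq: "p \<in> S" "q \<in> S"
  let ?\<gamma> = "\<lambda>t. (\<lambda>i. fst p i + t * (fst q i - fst p i), snd p + t * (snd q - snd p))"
  show "\<exists>\<gamma>. \<gamma> 0 = p \<and> \<gamma> 1 = q \<and> finite {t. \<gamma> t \<notin> S} \<and>
      (\<forall>g\<in>coords (Kn_times_K_space n). \<exists>q. \<forall>t. g (\<gamma> t) = poly q t)"
  proof (intro exI[of _ ?\<gamma>] conjI ballI)
    show "finite {t. ?\<gamma> t \<notin> S}" using line[of "fst p" "snd p" "fst q" "snd q"] pq by simp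
    fix g :: "(nat \<Rightarrow> 'k) \<times> 'k \<Rightarrow> 'k" assume "g \<in> coords (Kn_times_K_space n)"
    then consider i where "g = (\<lambda>p. fst p i)" | "g = (\<lambda>p. snd p)"
      by (auto simp: coords_Kn_times_K_space)
    then show "\<exists>q. \<forall>t. g (?\<gamma> t) = poly q t"
    proof cases
      case (1 i)
      then show ?thesis by (intro exI[of _ "[:fst p i, fst q i - fst p i:]"]) simp
    next
      case 2
      then show ?thesis by (intro exI[of _ "[:snd p, snd q - snd p:]"]) simp
    qed
  qed (simp_all add: prod_eq_iff)
qed (use S in simp_all)

lemma irreducible_in_parameter_flag:
  assumes "i \<le> n"
  shows "irreducible_in (zariski (Kn_times_K_space n)) (Kn i \<times> {s :: 'k::field_char_0})"
proof (rule irreducible_in_parameters)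
  show "Kn i \<times> {s} \<subseteq> Kn n \<times> UNIV" using Kn_mono[OF assms] by auto
  show "Kn i \<times> {s} \<noteq> {}" using zero_in_Kn[of i] by blast
  fix c d :: "nat \<Rightarrow> 'k" and \<alpha> \<beta> assume "(c, \<alpha>) \<in> Kn i \<times> {s}" "(d, \<beta>) \<in> Kn i \<times> {s}"
  then have "(\<lambda>i. c i + t * (d i - c i), \<alpha> + t * (\<beta> - \<alpha>)) \<in> Kn i \<times> {s}" for t
    using affine_line_in_Kn by auto
  then show "finite {t. (\<lambda>i. c i + t * (d i - c i), \<alpha> + t * (\<beta> - \<alpha>)) \<notin> Kn i \<times> {s}}" by simp
qed

lemma irreducible_in_parameter_space:
  "irreducible_in (zariski (Kn_times_K_space n)) (Kn n \<times> (UNIV :: 'k::field_char_0 set))"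
proof (rule irreducible_in_parameters)
  show "Kn n \<times> (UNIV :: 'k set) \<noteq> {}" using zero_in_Kn[of n] by blast
  fix c d :: "nat \<Rightarrow> 'k" and \<alpha> \<beta> :: 'k assume "(c, \<alpha>) \<in> Kn n \<times> UNIV" "(d, \<beta>) \<in> Kn n \<times> UNIV"
  then show "finite {t. (\<lambda>i. c i + t * (d i - c i), \<alpha> + t * (\<beta> - \<alpha>)) \<notin> Kn n \<times> UNIV}"
    by (simp add: affine_line_in_Kn)
qed simp

lemma irreducible_in_punctured_parameter_space:
  "irreducible_in (zariski (Kn_times_K_space n)) (Kn n \<times> (UNIV - {0 :: 'k::field_char_0}))"
proof (rule irreducible_in_parameters)
  have "((\<lambda>_. 0), 1) \<in> Kn n \<times> (UNIV - {0 :: 'k})" by simp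
  then show "Kn n \<times> (UNIV - {0 :: 'k}) \<noteq> {}" by (metis empty_iff)
  fix c d :: "nat \<Rightarrow> 'k" and \<alpha> \<beta> :: 'k
  assume *: "(c, \<alpha>) \<in> Kn n \<times> (UNIV - {0})" "(d, \<beta>) \<in> Kn n \<times> (UNIV - {0})"
  have "{t. (\<lambda>i. c i + t * (d i - c i), \<alpha> + t * (\<beta> - \<alpha>)) \<notin> Kn n \<times> (UNIV - {0})} \<subseteq>
      {t. poly [:\<alpha>, \<beta> - \<alpha>:] t = 0}"
    using * by (auto simp: affine_line_in_Kn)
  moreover have "finite {t. poly [:\<alpha>, \<beta> - \<alpha>:] t = 0}" using * by (intro poly_roots_finite) simp
  ultimately show "finite {t. (\<lambda>i. c i + t * (d i - c i), \<alpha> + t * (\<beta> - \<alpha>)) \<notin> Kn n \<times> (UNIV - {0})}"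
    by (rule finite_subset)
qed auto

lemma closed_parameter_flag:
  assumes "i \<le> n"
  shows "closedin (zariski (Kn_times_K_space n)) (Kn i \<times> {s :: 'k::field_char_0})"
proof -
  let ?P = "insert (\<lambda>p. snd p - s) ((\<lambda>j p. fst p j) ` {i + 1..n})"
  have "?P \<subseteq> poly_funs (Kn_times_K_space n)"
  proof (intro insert_subsetI image_subsetI)
    show "(\<lambda>p. snd p - s) \<in> poly_funs (Kn_times_K_space n)"
      by (intro poly_funs_diff poly_funs.const poly_funs.coord) (simp add: coords_Kn_times_K_space)
    fix j assume "j \<in> {i + 1..n}"
    then have "j \<in> {1..n}" by auto
    then show "(\<lambda>p. fst p j) \<in> poly_funs (Kn_times_K_space n)"
      by (intro poly_funs.coord) (simp add: coords_Kn_times_K_space)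
  qed
  moreover have "Kn i \<times> {s} = zero_locus (Kn_times_K_space n) ?P"
    using assms unfolding zero_locus_def points_Kn_times_K_space
    by (auto simp: Kn_def)
  ultimately show ?thesis unfolding closedin_zariski by (intro exI[of _ ?P] conjI)
qed

section \<open>Geometry of the strata\<close>

context evolution_algebra
begin

lemma coords_End_space:
  "coords (End_space scale n e) = (\<lambda>(i, j) f. co i (f (e j))) ` ({1..n} \<times> {1..n})"
  unfolding End_space_def by auto blast

lemma points_End_space [simp]: "points (End_space scale n e) = End scale"
  by (simp add: End_space_def)

lemma End_space_separated:
  assumes "x \<in> points (End_space scale n e)" "y \<in> points (End_space scale n e)"
    and g: "\<And>g. g \<in> coords (End_space scale n e) \<Longrightarrow> g x = g y"
  shows "x = y"
proof (rule End_eqI)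
  fix i j assume "i \<in> {1..n}" "j \<in> {1..n}"
  then have "(\<lambda>f. co i (f (e j))) \<in> coords (End_space scale n e)" by (auto simp: coords_End_space)
  from g[OF this] show "co i (x (e j)) = co i (y (e j))" .
qed (use assms in simp_all)

lemma matrix_entry_poly:
  "i \<in> {1..n} \<Longrightarrow> j \<in> {1..n} \<Longrightarrow> (\<lambda>f. co i (f (e j))) \<in> poly_funs (End_space scale n e)"
  by (intro poly_funs.coord) (auto simp: coords_End_space)

lemma T_polynomial: "polynomial_map (Kn_times_K_space n) (End_space scale n e) (T k)"
  unfolding polynomial_map_def
proof (intro conjI ballI)
  show "T k ` points (Kn_times_K_space n) \<subseteq> points (End_space scale n e)"
    using T_End by auto
  fix g assume "g \<in> coords (End_space scale n e)"
  then obtain i j where ij: "i \<in> {1..n}" "j \<in> {1..n}" "g = (\<lambda>f. co i (f (e j)))"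
    by (auto simp: coords_End_space)
  let ?h = "\<lambda>p. (if k \<le> j \<and> j < n \<and> i = j then 2 ^ (n - j) else 0) * snd p +
    (if i = n then 1 else 0) * fst p j"
  have "?h \<in> poly_funs (Kn_times_K_space n)"
    using ij by (intro poly_funs.add poly_funs.mult poly_funs.const poly_funs.coord)
      (simp_all add: coords_Kn_times_K_space)
  moreover have "g (T k p) = ?h p" for p
    using co_T_basis[OF ij(1,2), of k "fst p" "snd p"] by (auto simp: ij(3))
  ultimately show "\<exists>h\<in>poly_funs (Kn_times_K_space n). \<forall>p\<in>points (Kn_times_K_space n). g (T k p) = h p"
    by (intro bexI[of _ ?h]) simp_all
qed

lemma V0_eq: "V0 scale n e = T k ` (Kn n \<times> {0})"
  by (auto simp: V0_def T0_eq_T[of _ k])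

lemma Vk_closure_eq: "Vk scale n e k \<union> V0 scale n e = T k ` (Kn n \<times> UNIV)"
  unfolding Vk_def V0_eq[of k] image_Un[symmetric] by (rule arg_cong[of _ _ "image (T k)"]) auto

text \<open>The eigenvalue at \<open>e k\<close> is nonzero on the stratum of index \<open>k\<close> and zero on that of a larger index.\<close>
lemma Vk_disjoint:
  assumes "k < l" "l \<in> {1..n - 1}" "k \<in> {1..n - 1}"
  shows "Vk scale n e k \<inter> Vk scale n e l = {}"
proof (rule ccontr)
  assume "Vk scale n e k \<inter> Vk scale n e l \<noteq> {}"
  then obtain c d \<alpha> \<beta> where eq: "T k (c, \<alpha>) = T l (d, \<beta>)" and \<alpha>: "\<alpha> \<noteq> 0" by (auto simp: Vk_def)
  have "k \<in> {1..n}" "k < n" using assms by auto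
  then have "co k (T k (c, \<alpha>) (e k)) = 2 ^ (n - k) * \<alpha>" "co k (T l (d, \<beta>) (e k)) = 0"
    using assms(1) by (simp_all add: co_T_basis)
  then show False using \<alpha> by (simp add: eq)
qed

lemma irreducible_image_T:
  "irreducible_in (zariski (Kn_times_K_space n)) S \<Longrightarrow>
    irreducible_in (zariski (End_space scale n e)) (T k ` S)"
  by (rule polynomial_map_irreducible_image[OF T_polynomial])

lemma irreducible_Vk: "irreducible_in (zariski (End_space scale n e)) (Vk scale n e k)"
  unfolding Vk_def by (intro irreducible_image_T irreducible_in_punctured_parameter_space)

lemma irreducible_Vk_closure:
  "irreducible_in (zariski (End_space scale n e)) (Vk scale n e k \<union> V0 scale n e)"
  unfolding Vk_closure_eq by (intro irreducible_image_T irreducible_in_parameter_space)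

lemma T0_add: "T0 scale n e (\<lambda>i. c i + d i) = T0 scale n e c + T0 scale n e d"
  by (simp add: T0_def lin_ext_def fun_eq_iff scale_left_distrib scale_right_distrib sum.distrib)

lemma T0_scale: "T0 scale n e (\<lambda>i. r * c i) = fun_scale scale r (T0 scale n e c)"
  by (simp add: T0_def lin_ext_def fun_eq_iff fun_scale_def scale_sum_right mult.left_commute)

lemma T0_sum: "T0 scale n e (\<lambda>i. \<Sum>j\<in>I. f j i) = (\<Sum>j\<in>I. T0 scale n e (f j))"
proof (induction I rule: infinite_finite_induct)
  case (insert j I)
  then show ?case by (simp add: T0_add)
qed (simp_all add: T0_def lin_ext_def fun_eq_iff)

context
  assumes n2: "n \<ge> 2"
begin

lemma params_polynomial: "polynomial_map (End_space scale n e) (Kn_times_K_space n) params"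
  unfolding polynomial_map_def
proof (intro conjI ballI)
  show "params ` points (End_space scale n e) \<subseteq> points (Kn_times_K_space n)"
    by (auto simp: params_def Kn_def)
  fix g :: "(nat \<Rightarrow> 'k) \<times> 'k \<Rightarrow> 'k" assume "g \<in> coords (Kn_times_K_space n)"
  then consider i where "i \<in> {1..n}" "g = (\<lambda>p. fst p i)" | "g = (\<lambda>p. snd p)"
    by (auto simp: coords_Kn_times_K_space)
  then show "\<exists>h\<in>poly_funs (End_space scale n e). \<forall>f\<in>points (End_space scale n e). g (params f) = h f"
  proof cases
    case (1 i)
    then show ?thesis
      by (intro bexI[of _ "\<lambda>f. co n (f (e i))"] matrix_entry_poly) (auto simp: params_def)
  next
    case 2
    have "(\<lambda>f. 1 / 2 * co (n - 1) (f (e (n - 1)))) \<in> poly_funs (End_space scale n e)"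
      using n2 by (intro poly_funs.mult poly_funs.const matrix_entry_poly) auto
    then show ?thesis
      by (intro bexI[of _ "\<lambda>f. 1 / 2 * co (n - 1) (f (e (n - 1)))"]) (simp_all add: 2 params_def)
  qed
qed

lemma T_embedding:
  "k \<in> {1..n - 1} \<Longrightarrow> polynomial_embedding (Kn_times_K_space n) (End_space scale n e) (T k) params"
  unfolding polynomial_embedding_def using T_polynomial params_polynomial by (auto simp: params_T)

lemma T0_embedding:
  "polynomial_embedding (Kn_space n) (End_space scale n e) (T0 scale n e) (\<lambda>f. fst (params f))"
proof -
  have "polynomial_map (Kn_space n) (Kn_times_K_space n) (\<lambda>c. (c, 0 :: 'k))"
    unfolding polynomial_map_def
  proof (intro conjI ballI)
    fix g :: "(nat \<Rightarrow> 'k) \<times> 'k \<Rightarrow> 'k" assume "g \<in> coords (Kn_times_K_space n)"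
    then consider i where "i \<in> {1..n}" "g = (\<lambda>p. fst p i)" | "g = (\<lambda>p. snd p)"
      by (auto simp: coords_Kn_times_K_space)
    then show "\<exists>h\<in>poly_funs (Kn_space n). \<forall>c\<in>points (Kn_space n). g (c, 0) = h c"
    proof cases
      case (1 i)
      then show ?thesis
        by (intro bexI[of _ "\<lambda>c. c i"] poly_funs.coord) (auto simp: coords_Kn_space)
    next
      case 2
      then show ?thesis by (intro bexI[of _ "\<lambda>c. 0"] poly_funs.const) simp
    qed
  qed auto
  from polynomial_map_comp[OF this T_polynomial[of n]]
  have "polynomial_map (Kn_space n) (End_space scale n e) (T0 scale n e)"
    by (simp add: T0_eq_T[of _ n, symmetric])
  moreover have "polynomial_map (Kn_times_K_space n) (Kn_space n) (\<lambda>p. fst p :: nat \<Rightarrow> 'k)"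
    unfolding polynomial_map_def
  proof (intro conjI ballI)
    fix g :: "(nat \<Rightarrow> 'k) \<Rightarrow> 'k" assume "g \<in> coords (Kn_space n)"
    then obtain i where "i \<in> {1..n}" "g = (\<lambda>c. c i)" by (auto simp: coords_Kn_space)
    then show "\<exists>h\<in>poly_funs (Kn_times_K_space n). \<forall>p\<in>points (Kn_times_K_space n). g (fst p) = h p"
      by (intro bexI[of _ "\<lambda>p. fst p i"] poly_funs.coord) (auto simp: coords_Kn_times_K_space)
  qed auto
  from polynomial_map_comp[OF params_polynomial this]
  have "polynomial_map (End_space scale n e) (Kn_space n) (\<lambda>f. fst (params f))" .
  moreover have "fst (params (T0 scale n e c)) = c" if "c \<in> Kn n" for c
    using params_T[OF that, of "n - 1" 0] n2 by (simp add: T0_eq_T[of c "n - 1"])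
  ultimately show ?thesis by (simp add: polynomial_embedding_def)
qed

lemma V0_Vk_disjoint:
  assumes "k \<in> {1..n - 1}"
  shows "V0 scale n e \<inter> Vk scale n e k = {}"
proof -
  have "inj_on (T k) (Kn n \<times> UNIV)" using polynomial_embedding_inj_on[OF T_embedding[OF assms]] by simp
  then have "T k ` (Kn n \<times> {0}) \<inter> T k ` (Kn n \<times> (UNIV - {0})) = T k ` (Kn n \<times> {0} \<inter> Kn n \<times> (UNIV - {0}))"
    by (intro inj_on_image_Int[symmetric]) auto
  then show ?thesis unfolding V0_eq[of k] Vk_def by auto
qed

lemma closed_image_T:
  "k \<in> {1..n - 1} \<Longrightarrow> closedin (zariski (Kn_times_K_space n)) C \<Longrightarrow>
    closedin (zariski (End_space scale n e)) (T k ` C)"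
  by (rule polynomial_embedding_closed_image[OF T_embedding]) (auto intro: End_space_separated)

lemma closed_V0: "closedin (zariski (End_space scale n e)) (V0 scale n e)"
  unfolding V0_eq[of "n - 1"] using n2 by (intro closed_image_T closed_parameter_flag) auto

lemma closed_Vk_closure:
  assumes "k \<in> {1..n - 1}"
  shows "closedin (zariski (End_space scale n e)) (Vk scale n e k \<union> V0 scale n e)"
proof -
  have "closedin (zariski (Kn_times_K_space n)) (Kn n \<times> (UNIV :: 'k set))"
    using closedin_topspace[of "zariski (Kn_times_K_space n)"] by simp
  from closed_image_T[OF assms this] show ?thesis by (simp only: Vk_closure_eq)
qed

text \<open>The irreducible set \<open>Vk \<union> V0\<close> is the union of two closed sets, the closure of \<open>Vk\<close> and \<open>V0\<close>, so one of
  them is everything; it is not \<open>V0\<close>, from which \<open>Vk\<close> is disjoint.\<close>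
lemma closure_of_Vk:
  assumes k: "k \<in> {1..n - 1}"
  shows "zariski (End_space scale n e) closure_of Vk scale n e k = Vk scale n e k \<union> V0 scale n e"
proof
  let ?X = "zariski (End_space scale n e)"
  show "?X closure_of Vk scale n e k \<subseteq> Vk scale n e k \<union> V0 scale n e"
    by (intro closure_of_minimal closed_Vk_closure[OF k]) simp
  have sub: "Vk scale n e k \<subseteq> ?X closure_of Vk scale n e k"
    using irreducible_Vk[of k] by (intro closure_of_subset) (simp add: irreducible_in_def)
  then have "Vk scale n e k \<union> V0 scale n e \<subseteq> ?X closure_of Vk scale n e k \<union> V0 scale n e" by blast
  then have "Vk scale n e k \<union> V0 scale n e \<subseteq> ?X closure_of Vk scale n e k \<or>
      Vk scale n e k \<union> V0 scale n e \<subseteq> V0 scale n e"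
    by (rule irreducible_in_subset_cases[OF irreducible_Vk_closure closedin_closure_of closed_V0])
  moreover have "Vk scale n e k \<noteq> {}" using irreducible_Vk[of k] by (simp add: irreducible_in_iff)
  ultimately show "Vk scale n e k \<union> V0 scale n e \<subseteq> ?X closure_of Vk scale n e k"
    using V0_Vk_disjoint[OF k] by blast
qed

lemma quasi_affine_Vk:
  assumes k: "k \<in> {1..n - 1}"
  shows "quasi_affine (End_space scale n e) (Vk scale n e k)"
  unfolding quasi_affine_def
proof (intro exI conjI)
  let ?X = "zariski (End_space scale n e)"
  show "openin ?X (topspace ?X - V0 scale n e)"
    using closed_V0 by (rule openin_diff[OF openin_topspace])
  show "closedin ?X (Vk scale n e k \<union> V0 scale n e)" by (rule closed_Vk_closure[OF k])
  show "Vk scale n e k = (topspace ?X - V0 scale n e) \<inter> (Vk scale n e k \<union> V0 scale n e)"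
    using V0_Vk_disjoint[OF k] irreducible_Vk[of k] by (auto simp: irreducible_in_def)
qed

section \<open>Dimensions\<close>

lemma flag_psubset:
  assumes k: "k \<in> {1..n - 1}" and "i < n"
  shows "T k ` (Kn i \<times> {s}) \<subset> T k ` (Kn (Suc i) \<times> {s})"
proof -
  have inj: "inj_on (T k) (Kn n \<times> UNIV)" using polynomial_embedding_inj_on[OF T_embedding[OF k]] by simp
  have "Kn i \<times> {s} \<subset> Kn (Suc i) \<times> {s}" using Kn_psubset[OF assms(2)] by blast
  moreover have "Kn (Suc i) \<times> {s} \<subseteq> Kn n \<times> UNIV" using Kn_mono[of "Suc i" n] assms(2) by auto
  ultimately show ?thesis using inj by (intro image_strict_mono) (auto intro: inj_on_subset)
qed

lemma krull_dim_V0: "krull_dim (subtopology (zariski (End_space scale n e)) (V0 scale n e)) = enat n"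
proof (rule antisym)
  show "krull_dim (subtopology (zariski (End_space scale n e)) (V0 scale n e)) \<le> enat n"
  proof (rule krull_dim_le_chain)
    fix r Z
    assume Z: "\<And>i. i \<le> r \<Longrightarrow> closedin (subtopology (zariski (End_space scale n e)) (V0 scale n e)) (Z i) \<and>
        irreducible_in (subtopology (zariski (End_space scale n e)) (V0 scale n e)) (Z i)"
      "\<And>i. i < r \<Longrightarrow> Z i \<subset> Z (Suc i)"
    have "Z r \<subseteq> T0 scale n e ` points (Kn_space n)"
      using Z(1)[of r] by (simp add: irreducible_in_subtopology V0_def)
    from irreducible_chain_in_embedding_length_le[OF T0_embedding card_coords_Kn_space(2) Z this]
    show "r \<le> n" using card_coords_Kn_space(1) by (rule order_trans)
  qed
  have k: "n - 1 \<in> {1..n - 1}" using n2 by auto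
  show "enat n \<le> krull_dim (subtopology (zariski (End_space scale n e)) (V0 scale n e))"
  proof (rule krull_dim_ge_chain[where Z = "\<lambda>i. T (n - 1) ` (Kn i \<times> {0})"])
    fix i assume "i \<le> n"
    then show "closedin (subtopology (zariski (End_space scale n e)) (V0 scale n e)) (T (n - 1) ` (Kn i \<times> {0})) \<and>
      irreducible_in (subtopology (zariski (End_space scale n e)) (V0 scale n e)) (T (n - 1) ` (Kn i \<times> {0}))"
      using Kn_mono[of i n] unfolding irreducible_in_subtopology V0_eq[of "n - 1"]
      by (intro conjI closedin_subset_subtopology closed_image_T[OF k] irreducible_image_T
          closed_parameter_flag irreducible_in_parameter_flag image_mono) auto
  qed (rule flag_psubset[OF k])
qed

text \<open>A coordinate flag of length \<open>n\<close> at a fixed value \<open>s\<close> of \<open>\<alpha>\<close>, followed by one larger irreducible set. For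
  \<open>Vk\<close> the value is \<open>s = 1\<close>, as \<open>\<alpha> = 0\<close> is excluded there; for the set of all local operators it
  is \<open>s = 0\<close>.\<close>
lemma krull_dim_ge_flag:
  assumes k: "k \<in> {1..n - 1}" and S: "T k ` (Kn n \<times> {s}) \<subset> W" "W \<subseteq> S"
    and W: "closedin (subtopology (zariski (End_space scale n e)) S) W"
      "irreducible_in (zariski (End_space scale n e)) W"
  shows "enat (n + 1) \<le> krull_dim (subtopology (zariski (End_space scale n e)) S)"
proof (rule krull_dim_ge_chain[where Z = "\<lambda>i. if i \<le> n then T k ` (Kn i \<times> {s}) else W"])
  fix i assume "i \<le> n + 1"
  have "T k ` (Kn i \<times> {s}) \<subseteq> S" if "i \<le> n"
    using S Kn_mono[OF that] by blast
  then show "closedin (subtopology (zariski (End_space scale n e)) S) (if i \<le> n then T k ` (Kn i \<times> {s}) else W) \<and>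
      irreducible_in (subtopology (zariski (End_space scale n e)) S) (if i \<le> n then T k ` (Kn i \<times> {s}) else W)"
    using S W by (auto simp: irreducible_in_subtopology intro!: closedin_subset_subtopology closed_image_T[OF k]
        irreducible_image_T closed_parameter_flag irreducible_in_parameter_flag)
next
  fix i assume "i < n + 1"
  then consider "i < n" | "i = n" by linarith
  then show "(if i \<le> n then T k ` (Kn i \<times> {s}) else W) \<subset> (if Suc i \<le> n then T k ` (Kn (Suc i) \<times> {s}) else W)"
  proof cases
    case 1
    then show ?thesis using flag_psubset[OF k 1, of s] by simp
  qed (use S(1) in simp)
qed

lemma krull_dim_le_Vk_cover:
  assumes K: "K \<subseteq> {1..n - 1}" and S: "S \<subseteq> (\<Union>k\<in>K. Vk scale n e k \<union> V0 scale n e)"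
  shows "krull_dim (subtopology (zariski (End_space scale n e)) S) \<le> enat (n + 1)"
proof (rule krull_dim_le_chain)
  fix r Z
  assume Z: "\<And>i. i \<le> r \<Longrightarrow> closedin (subtopology (zariski (End_space scale n e)) S) (Z i) \<and>
      irreducible_in (subtopology (zariski (End_space scale n e)) S) (Z i)"
    "\<And>i. i < r \<Longrightarrow> Z i \<subset> Z (Suc i)"
  have "irreducible_in (zariski (End_space scale n e)) (Z r)" "Z r \<subseteq> S"
    using Z(1)[of r] by (simp_all add: irreducible_in_subtopology)
  moreover have "finite K" using K finite_subset by blast
  ultimately have "\<exists>C\<in>(\<lambda>k. Vk scale n e k \<union> V0 scale n e) ` K. Z r \<subseteq> C"
    using S K closed_Vk_closure by (intro irreducible_in_finite_cover[of _ "zariski (End_space scale n e)"]) blast+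
  then obtain k where k: "k \<in> K" "Z r \<subseteq> T k ` points (Kn_times_K_space n)"
    by (auto simp: Vk_closure_eq)
  then have "k \<in> {1..n - 1}" using K by blast
  from irreducible_chain_in_embedding_length_le[OF T_embedding[OF this] card_coords_Kn_times_K_space(2) Z k(2)]
  show "r \<le> n + 1" using card_coords_Kn_times_K_space(1) by (rule order_trans)
qed

lemma krull_dim_Vk:
  assumes k: "k \<in> {1..n - 1}"
  shows "krull_dim (subtopology (zariski (End_space scale n e)) (Vk scale n e k)) = enat (n + 1)"
proof (rule antisym)
  show "krull_dim (subtopology (zariski (End_space scale n e)) (Vk scale n e k)) \<le> enat (n + 1)"
    using k by (intro krull_dim_le_Vk_cover[of "{k}"]) auto
  have inj: "inj_on (T k) (Kn n \<times> (UNIV - {0}))"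
    using polynomial_embedding_inj_on[OF T_embedding[OF k]] by (rule inj_on_subset) auto
  show "enat (n + 1) \<le> krull_dim (subtopology (zariski (End_space scale n e)) (Vk scale n e k))"
  proof (rule krull_dim_ge_flag[OF k])
    have "((\<lambda>_. 0), 2 :: 'k) \<in> Kn n \<times> (UNIV - {0}) - Kn n \<times> {1}" by simp
    moreover have "Kn n \<times> {1 :: 'k} \<subseteq> Kn n \<times> (UNIV - {0})" by auto
    ultimately have "Kn n \<times> {1 :: 'k} \<subset> Kn n \<times> (UNIV - {0})" by blast
    then show "T k ` (Kn n \<times> {1}) \<subset> Vk scale n e k"
      unfolding Vk_def by (rule image_strict_mono[OF inj])
    have "Vk scale n e k \<subseteq> topspace (zariski (End_space scale n e))"
      using irreducible_Vk[of k] by (simp add: irreducible_in_def)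
    then show "closedin (subtopology (zariski (End_space scale n e)) (Vk scale n e k)) (Vk scale n e k)"
      by (metis closedin_topspace topspace_subtopology_subset)
  qed (simp_all add: irreducible_Vk)
qed

section \<open>The linear structure of the closed stratum\<close>

lemma V0_affine_subspace: "affine_subspace_of_dim scale (V0 scale n e) n"
proof -
  interpret F: vector_space "fun_scale scale :: 'k \<Rightarrow> ('v \<Rightarrow> 'v) \<Rightarrow> 'v \<Rightarrow> 'v"
    by (rule vector_space_fun_scale) (rule vector_space_axioms)
  have inj: "inj_on (T0 scale n e) (Kn n)" using polynomial_embedding_inj_on[OF T0_embedding] by simp
  have T0_zero: "T0 scale n e (\<lambda>_. 0) = 0" by (simp add: T0_def lin_ext_def fun_eq_iff)
  have sub: "F.subspace (V0 scale n e)"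
  proof (rule F.subspaceI)
    show "0 \<in> V0 scale n e" unfolding V0_def T0_zero[symmetric] by (rule imageI) simp
    fix f g assume "f \<in> V0 scale n e" "g \<in> V0 scale n e"
    then obtain c d where "c \<in> Kn n" "d \<in> Kn n" "f = T0 scale n e c" "g = T0 scale n e d"
      by (auto simp: V0_def)
    then show "f + g \<in> V0 scale n e"
      unfolding V0_def by (intro image_eqI[of _ _ "\<lambda>i. c i + d i"]) (simp_all add: T0_add Kn_def)
  next
    fix r f assume "f \<in> V0 scale n e"
    then obtain c where "c \<in> Kn n" "f = T0 scale n e c" by (auto simp: V0_def)
    then show "fun_scale scale r f \<in> V0 scale n e"
      unfolding V0_def by (intro image_eqI[of _ _ "\<lambda>i. r * c i"]) (simp_all add: T0_scale Kn_def)
  qed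
  define u :: "nat \<Rightarrow> nat \<Rightarrow> 'k" where "u i j = (if i = j then 1 else 0)" for i j
  define b where "b i = T0 scale n e (u i)" for i
  have u: "u i \<in> Kn n" if "i \<in> {1..n}" for i using that by (auto simp: u_def Kn_def)
  have comb: "(\<Sum>i = 1..n. fun_scale scale (c i) (b i)) = T0 scale n e (\<lambda>j. if j \<in> {1..n} then c j else 0)" for c
  proof -
    have "(\<Sum>i = 1..n. fun_scale scale (c i) (b i)) = T0 scale n e (\<lambda>j. \<Sum>i = 1..n. c i * u i j)"
      by (simp only: b_def T0_scale[symmetric] T0_sum)
    also have "(\<lambda>j. \<Sum>i = 1..n. c i * u i j) = (\<lambda>j. if j \<in> {1..n} then c j else 0)"
      by (simp add: u_def fun_eq_iff if_distrib cong: if_cong)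
    finally show ?thesis .
  qed
  have inj_b: "inj_on b {1..n}"
  proof
    fix i j assume ij: "i \<in> {1..n}" "j \<in> {1..n}" "b i = b j"
    then have "u i = u j" using inj_onD[OF inj _ u u] by (simp add: b_def)
    then have "u i j = u j j" by simp
    then show "i = j" by (simp add: u_def split: if_splits)
  qed
  have "F.independent (b ` {1..n})"
  proof (rule F.independent_if_scalars_zero)
    fix f x assume f: "(\<Sum>x\<in>b ` {1..n}. fun_scale scale (f x) x) = 0" and "x \<in> b ` {1..n}"
    then obtain i where i: "i \<in> {1..n}" "x = b i" by auto
    let ?c = "\<lambda>j. if j \<in> {1..n} then f (b j) else 0"
    have "T0 scale n e ?c = (\<Sum>i = 1..n. fun_scale scale (f (b i)) (b i))"
      by (rule comb[symmetric])
    also have "\<dots> = T0 scale n e (\<lambda>_. 0)" using f by (simp only: sum.reindex[OF inj_b] o_def T0_zero)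
    finally have "?c = (\<lambda>_. 0)" by (rule inj_onD[OF inj]) (simp_all add: Kn_def)
    from fun_cong[OF this, of i] show "f x = 0" using i by simp
  qed simp
  moreover have "F.span (b ` {1..n}) = F.span (V0 scale n e)"
  proof
    show "F.span (b ` {1..n}) \<subseteq> F.span (V0 scale n e)"
      using u by (intro F.span_mono) (auto simp: b_def V0_def)
    have "V0 scale n e \<subseteq> F.span (b ` {1..n})"
    proof
      fix f assume "f \<in> V0 scale n e"
      then obtain c where c: "c \<in> Kn n" "f = T0 scale n e c" by (auto simp: V0_def)
      then have "(\<lambda>j. if j \<in> {1..n} then c j else 0) = c" by (auto simp: Kn_def fun_eq_iff)
      then have "f = (\<Sum>i = 1..n. fun_scale scale (c i) (b i))" using comb[of c] c(2) by simp
      moreover have "(\<Sum>i = 1..n. fun_scale scale (c i) (b i)) \<in> F.span (b ` {1..n})"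
        by (intro F.span_sum F.span_scale F.span_base imageI)
      ultimately show "f \<in> F.span (b ` {1..n})" by simp
    qed
    then show "F.span (V0 scale n e) \<subseteq> F.span (b ` {1..n})"
      by (intro F.span_minimal) simp_all
  qed
  ultimately have "F.dim (V0 scale n e) = n"
    using F.dim_eq_card[of "b ` {1..n}" "V0 scale n e"] card_image[OF inj_b] by simp
  moreover have "V0 scale n e \<subseteq> End scale" unfolding V0_eq[of n] using T_End by auto
  moreover have "V0 scale n e = (\<lambda>w. 0 + w) ` V0 scale n e" by simp
  ultimately show ?thesis unfolding affine_subspace_of_dim_def using sub by blast
qed

end

end

section \<open>Decomposition into strata\<close>

context max_nilindex_normal_form
begin

lemma krull_dim_LRB0:
  "krull_dim (subtopology (zariski (End_space scale n e)) (LRB0 scale mul)) = enat (n + 1)"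
proof (rule antisym)
  have n2: "n \<ge> 2" using n_ge_3 by simp
  have top: "n - 1 \<in> {i0 + 1..n - 1}" using obstruction_index_bound[OF n_ge_3, of a] by simp
  then have k: "n - 1 \<in> {1..n - 1}" by auto
  have "V0 scale n e \<union> (\<Union>k\<in>{i0 + 1..n - 1}. Vk scale n e k) =
      (\<Union>k\<in>{i0 + 1..n - 1}. Vk scale n e k \<union> V0 scale n e)" using top by blast
  then have LRB0: "LRB0 scale mul = (\<Union>k\<in>{i0 + 1..n - 1}. Vk scale n e k \<union> V0 scale n e)"
    by (simp only: LRB0_eq)
  show "krull_dim (subtopology (zariski (End_space scale n e)) (LRB0 scale mul)) \<le> enat (n + 1)"
    by (rule krull_dim_le_Vk_cover[OF n2, of "{i0 + 1..n - 1}"]) (auto simp: LRB0)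
  let ?W = "Vk scale n e (n - 1) \<union> V0 scale n e"
  show "enat (n + 1) \<le> krull_dim (subtopology (zariski (End_space scale n e)) (LRB0 scale mul))"
  proof (rule krull_dim_ge_flag[OF n2 k, of 0 ?W])
    have "Vk scale n e (n - 1) \<noteq> {}" using irreducible_Vk by (simp add: irreducible_in_iff)
    then show "T (n - 1) ` (Kn n \<times> {0}) \<subset> ?W"
      using V0_Vk_disjoint[OF n2 k] unfolding V0_eq[of "n - 1", symmetric] by blast
    show sub: "?W \<subseteq> LRB0 scale mul" unfolding LRB0 using top by blast
    show "closedin (subtopology (zariski (End_space scale n e)) (LRB0 scale mul)) ?W"
      by (rule closedin_subset_subtopology[OF closed_Vk_closure[OF n2 k] sub])
    show "irreducible_in (zariski (End_space scale n e)) ?W" by (rule irreducible_Vk_closure)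
  qed
qed

end

theorem proposition5p1:
  fixes scale :: "'k::field_char_0 \<Rightarrow> 'v::ab_group_add \<Rightarrow> 'v"
    and mul :: "'v \<Rightarrow> 'v \<Rightarrow> 'v" and n i0 :: nat and e :: "nat \<Rightarrow> 'v"
    and a :: "nat \<Rightarrow> nat \<Rightarrow> 'k"
  assumes E: "max_nilindex_normal_form scale mul n e a"
    and i0: "i0 = obstruction_index n a"
  shows
    "(LRB0 scale mul = V0 scale n e \<union> (\<Union>k\<in>{i0 + 1..n - 1}. Vk scale n e k)) \<and>
     (V0 scale n e \<inter> (\<Union>k\<in>{i0 + 1..n - 1}. Vk scale n e k) = {}) \<and>
     (disjoint_family_on (Vk scale n e) {i0 + 1..n - 1}) \<and>
     (affine_subspace_of_dim scale (V0 scale n e) n) \<and>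
     (krull_dim (subtopology (zariski (End_space scale n e)) (V0 scale n e)) = enat n) \<and>
     (variety_iso (Kn_space n) (Kn n) (End_space scale n e) (V0 scale n e) (T0 scale n e)) \<and>
     (\<forall>c\<in>Kn n. \<forall>d\<in>Kn n. T0 scale n e (c + d) = T0 scale n e c + T0 scale n e d) \<and>
     (\<forall>r. \<forall>c\<in>Kn n. T0 scale n e (\<lambda>i. r * c i) = fun_scale scale r (T0 scale n e c)) \<and>
     (\<forall>k\<in>{i0 + 1..n - 1}.
        quasi_affine (End_space scale n e) (Vk scale n e k) \<and>
        irreducible_in (zariski (End_space scale n e)) (Vk scale n e k) \<and>
        variety_iso (Kn_times_K_space n) (Kn n \<times> (UNIV - {0}))
          (End_space scale n e) (Vk scale n e k) (Tk scale n e k) \<and>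
        krull_dim (subtopology (zariski (End_space scale n e)) (Vk scale n e k)) = enat (n + 1)) \<and>
     (\<forall>k\<in>{i0 + 1..n - 1}.
        zariski (End_space scale n e) closure_of Vk scale n e k = Vk scale n e k \<union> V0 scale n e \<and>
        zariski (End_space scale n e) closure_of Vk scale n e k - Vk scale n e k = V0 scale n e) \<and>
     (krull_dim (subtopology (zariski (End_space scale n e)) (LRB0 scale mul)) = enat (n + 1))"
proof -
  interpret max_nilindex_normal_form scale mul n e a by (rule E)
  have n2: "n \<ge> 2" using n_ge_3 by simp
  have k_range: "k \<in> {1..n - 1}" if "k \<in> {i0 + 1..n - 1}" for k using that by auto
  have disj: "disjoint_family_on (Vk scale n e) {i0 + 1..n - 1}"
    unfolding disjoint_family_on_def
  proof (intro ballI impI)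
    fix k l assume kl: "k \<in> {i0 + 1..n - 1}" "l \<in> {i0 + 1..n - 1}" "k \<noteq> l"
    then consider "k < l" | "l < k" by linarith
    then show "Vk scale n e k \<inter> Vk scale n e l = {}"
      using Vk_disjoint[OF _ k_range k_range] kl by cases blast+
  qed
  have "variety_iso (Kn_space n) (Kn n) (End_space scale n e) (V0 scale n e) (T0 scale n e)"
    unfolding V0_def by (rule polynomial_embedding_variety_iso[OF T0_embedding[OF n2]]) simp
  moreover have "variety_iso (Kn_times_K_space n) (Kn n \<times> (UNIV - {0}))
      (End_space scale n e) (Vk scale n e k) (Tk scale n e k)" if "k \<in> {i0 + 1..n - 1}" for k
    unfolding Vk_def
    by (rule polynomial_embedding_variety_iso[OF T_embedding[OF n2 k_range[OF that]]]) auto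
  moreover have "T0 scale n e (c + d) = T0 scale n e c + T0 scale n e d" for c d
    using T0_add[of c d] by (simp add: plus_fun_def)
  moreover have "V0 scale n e \<inter> (\<Union>k\<in>{i0 + 1..n - 1}. Vk scale n e k) = {}"
    using V0_Vk_disjoint[OF n2 k_range] by blast
  moreover have "zariski (End_space scale n e) closure_of Vk scale n e k - Vk scale n e k = V0 scale n e"
    if "k \<in> {i0 + 1..n - 1}" for k
    using closure_of_Vk[OF n2 k_range[OF that]] V0_Vk_disjoint[OF n2 k_range[OF that]] by blast
  ultimately show ?thesis
    using LRB0_eq[folded i0] disj V0_affine_subspace[OF n2] krull_dim_V0[OF n2] T0_scale
      quasi_affine_Vk[OF n2 k_range] irreducible_Vk krull_dim_Vk[OF n2 k_range]
      closure_of_Vk[OF n2 k_range] krull_dim_LRB0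
    by (intro conjI ballI allI) assumption+
qed

end
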